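(* Let $H>0$, let $Z$ be an offspring distribution with $m:=\mathbb{E}[Z]\in(1,\infty)$, and let $Y$ be a real-valued random variable with $\mathbb{E}[|Y|^\alpha]<\infty$ for some $\alpha>0$. Let $\{X_t\}_{t\in\mathcal{T}}$ be the discounted branching random walk with offspring distribution $Z$, increment law $Y$ and discounting factor $H$, i.e. $X_t=\sum_{i\ge 1}m^{-iH}\eta_{t_i}$. The following hold. (i) If there exists $q>\max\{1/H,1\}$ such that $\mathbb{E}[Z^q]<\infty$, and if $\mathbb{E}[|Y|^{1/H}]<\infty$, then $\sup_{t\in\mathcal{T}}|X_t|<\infty$ almost surely. (ii) If $\mathbb{P}(Z=0)=0$, $\mathbb{E}[Z\log Z]<\infty$, and $\mathbb{E}[|Y|^{1/H}]=\infty$, then $\sup_{t\in\mathcal{T}}|X_t|=\infty$ almost surely. In particular, if $Z$ has finite moments of all orders and $\mathbb{P}(Z=0)=0$, then for all $H>0$, $\sup_{t\in\mathcal{T}}|X_t|<\infty$ almost surely if and only if $\mathbb{E}[|Y|^{1/H}]<\infty$.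
   Context: Consider a Galton--Watson tree with offspring distribution $Z$ (a random variable with values in $\{0,1,2,\dots\}$) with $m=\mathbb{E}[Z]>1$. $\mathcal{T}$ is the set of rays, i.e. infinite paths from the root to the boundary of the tree. $V_n$ is the set of vertices at distance $n$ from the root, and $V=\bigcup_{n\ge1}V_n$ is the set of non-root vertices. To the vertices $v\in V$ are attached i.i.d. real random variables $\eta_v$ with the law of $Y$, independent of the tree. For a ray $t\in\mathcal{T}$ and $i\ge1$, $t_i$ is the unique vertex of $V_i$ on $t$. The discounted branching random walk is $$X_t:=\sum_{i\ge1}m^{-iH}\eta_{t_i},\qquad t\in\mathcal{T}.$$ The assumption $\mathbb{E}[|Y|^\alpha]<\infty$ for some $\alpha>0$ is made so that this series is well-defined. If $\mathcal{T}$ is empty, $\sup_{t\in\mathcal{T}}X_t=\sup_{t\in\mathcal{T}}|X_t|=0$ by convention. *)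

theory Defs
  imports "HOL-Probability.Probability"
begin

text \<open>
  Vertices carry Ulam--Harris labels: the root is \<^term>\<open>[]\<close> and the children of \<open>v\<close> are
  \<open>v @ [k]\<close> for \<open>k < N v\<close>, where \<open>N v\<close> is the number of offspring of \<open>v\<close>.
\<close>

definition gw_tree :: "(nat list \<Rightarrow> nat) \<Rightarrow> nat list set" where
  "gw_tree N = {v. \<forall>i<length v. v ! i < N (take i v)}"

definition ray_vertex :: "(nat \<Rightarrow> nat) \<Rightarrow> nat \<Rightarrow> nat list" where
  "ray_vertex t i = map t [0..<i]"

definition rays :: "(nat list \<Rightarrow> nat) \<Rightarrow> (nat \<Rightarrow> nat) set" where
  "rays N = {t. \<forall>i. ray_vertex t i \<in> gw_tree N}"

text \<open>The index is shifted by one, since the series starts at level 1.\<close>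

definition dbrw_term :: "real \<Rightarrow> real \<Rightarrow> (nat list \<Rightarrow> real) \<Rightarrow> (nat \<Rightarrow> nat) \<Rightarrow> nat \<Rightarrow> real" where
  "dbrw_term m H \<eta> t i = m powr (- (real (Suc i) * H)) * \<eta> (ray_vertex t (Suc i))"

definition dbrw :: "real \<Rightarrow> real \<Rightarrow> (nat list \<Rightarrow> real) \<Rightarrow> (nat \<Rightarrow> nat) \<Rightarrow> real" where
  "dbrw m H \<eta> t = (\<Sum>i. dbrw_term m H \<eta> t i)"

text \<open>
  A moment \<open>E[|Y|^\<alpha>] < \<infinity>\<close> makes the series converge almost surely along each fixed label sequence,
  but not necessarily along all of the uncountably many rays at once. The supremum therefore
  ranges over the rays on which the series converges, so that divergent rays (where
  \<^const>\<open>suminf\<close> has no meaning) never contribute. In \<^typ>\<open>ennreal\<close> the supremum of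
  the empty set is 0, which is the convention for a tree without rays.
\<close>

definition dbrw_sup :: "real \<Rightarrow> real \<Rightarrow> (nat list \<Rightarrow> nat) \<Rightarrow> (nat list \<Rightarrow> real) \<Rightarrow> ennreal" where
  "dbrw_sup m H N \<eta> =
     (SUP t\<in>{t \<in> rays N. summable (dbrw_term m H \<eta> t)}. ennreal \<bar>dbrw m H \<eta> t\<bar>)"

text \<open>
  The offspring numbers of all labels and the increments of all non-root labels are mutually
  independent. The independence is stated through the generated families of events because
  \<^const>\<open>prob_space.indep_vars\<close> needs one common value type.
\<close>

locale dbrw_environment = prob_space M for M :: "'w measure" +
  fixes Z :: "nat pmf" and Y :: "real measure"
    and N :: "nat list \<Rightarrow> 'w \<Rightarrow> nat" and \<eta> :: "nat list \<Rightarrow> 'w \<Rightarrow> real"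
  assumes N_measurable: "\<And>v. random_variable (count_space UNIV) (N v)"
    and N_distr: "\<And>v. distr M (count_space UNIV) (N v) = measure_pmf Z"
    and \<eta>_measurable: "\<And>v. v \<noteq> [] \<Longrightarrow> random_variable borel (\<eta> v)"
    and \<eta>_distr: "\<And>v. v \<noteq> [] \<Longrightarrow> distr M borel (\<eta> v) = Y"
    and independence: "indep_sets
          (case_sum (\<lambda>v. {N v -` A \<inter> space M | A. A \<in> sets (count_space UNIV)})
                    (\<lambda>v. {\<eta> v -` A \<inter> space M | A. A \<in> sets borel}))
          (UNIV <+> {v. v \<noteq> []})"

end

theory Submission imports Defs begin

text \<open>
  (i) Write \<open>x i = m ^ (- i H) * \<bar>\<eta>\<bar>\<close> for the \<open>i\<close>-th vertex on a ray. A many-to-one computation with the weight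
  \<open>\<theta> ^ #(exceeding ancestors)\<close>, \<open>\<theta>\<close> large, shows that the expected number of vertices beyond level \<open>a k\<close>
  that satisfy \<open>x > 2 ^ - k\<close> and have \<open>k\<close> ancestors doing the same beyond level \<open>a k\<close> is \<open>O(2 ^ - k)\<close>.
  By Borel--Cantelli every ray has eventually at most \<open>(a + 1) k\<close> terms above \<open>2 ^ - k\<close>, uniformly over the rays,
  and summation over the layers bounds the series.

  (ii) Let \<open>u j\<close> bound the probability that no descendant \<open>w\<close> of a given vertex at level \<open>j\<close> has
  \<open>\<bar>\<eta> w\<bar> > K m ^ (\<bar>w\<bar> H)\<close>. With \<open>f\<close> the generating function of \<open>Z\<close> and \<open>p j = P(\<bar>Y\<bar> > K m ^ (j H))\<close>, branching gives
  \<open>u j \<le> f ((1 - p (j + 1)) * u (j + 1))\<close>. The \<open>Z log Z\<close> condition controls \<open>f\<close> near 1 well enough that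
  \<open>\<Sum>j. m ^ j * p j = \<infinity>\<close> forces \<open>u = 0\<close>. Hence partial sums are unbounded over the tree. The first vertex with a
  large partial sum is independent of the increments on the leftmost path below it, and the contribution of
  that path is tight, so with probability close to 1 some convergent ray has a large value.
\<close>

subsection \<open>Independence and the many-to-one formula\<close>

context dbrw_environment
begin

text \<open>\<open>Inl v\<close> stands for the offspring number of \<open>v\<close> and
  \<open>Inr v\<close> for its increment; the root has no increment.\<close>

definition indices :: "(nat list + nat list) set" where
  "indices = UNIV <+> {v. v \<noteq> []}"

definition coord :: "nat list + nat list \<Rightarrow> 'w set set" where
  "coord = case_sum (\<lambda>v. {N v -` A \<inter> space M | A. A \<in> sets (count_space UNIV)})
                    (\<lambda>v. {\<eta> v -` A \<inter> space M | A. A \<in> sets borel})"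

text \<open>The sigma-algebra generated by the coordinates in \<open>K\<close>. Every use of
  independence below concerns such sigma-algebras over disjoint sets of coordinates.\<close>

definition info :: "(nat list + nat list) set \<Rightarrow> 'w measure" where
  "info K = sigma (space M) (\<Union>i\<in>K. coord i)"

lemma coord_subset_Pow: "coord i \<subseteq> Pow (space M)"
  by (auto simp: coord_def split: sum.splits)

lemma space_info [simp]: "space (info K) = space M"
  unfolding info_def by (rule space_measure_of) (use coord_subset_Pow in blast)

lemma sets_info: "sets (info K) = sigma_sets (space M) (\<Union>i\<in>K. coord i)"
  unfolding info_def by (rule sets_measure_of) (use coord_subset_Pow in blast)

lemma measurable_info_N: "Inl v \<in> K \<Longrightarrow> N v \<in> measurable (info K) (count_space UNIV)"
  by (rule measurableI, simp, unfold sets_info space_info, rule sigma_sets.Basic, 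
      auto simp: coord_def intro!: bexI[of _ "Inl v"] exI)

lemma measurable_info_eta: "Inr v \<in> K \<Longrightarrow> \<eta> v \<in> measurable (info K) borel"
  by (rule measurableI, simp, unfold sets_info space_info, rule sigma_sets.Basic, 
      auto simp: coord_def intro!: bexI[of _ "Inr v"] exI)

lemma Int_stable_coord: "Int_stable (coord i)"
proof (cases i)
  case (Inl v)
  show ?thesis
  proof (intro Int_stableI)
    fix a b assume "a \<in> coord i" "b \<in> coord i"
    then obtain A B where "a = N v -` A \<inter> space M" "b = N v -` B \<inter> space M"
      unfolding coord_def Inl by auto
    then show "a \<inter> b \<in> coord i"
      unfolding coord_def Inl by (auto intro!: exI[of _ "A \<inter> B"])
  qed
next
  case (Inr v)
  show ?thesis
  proof (intro Int_stableI)
    fix a b assume "a \<in> coord i" "b \<in> coord i"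
    then obtain A B where "a = \<eta> v -` A \<inter> space M" "b = \<eta> v -` B \<inter> space M" "A \<in> sets borel" "B \<in> sets borel"
      unfolding coord_def Inr by auto
    then show "a \<inter> b \<in> coord i"
      unfolding coord_def Inr by (auto intro!: exI[of _ "A \<inter> B"])
  qed
qed

text \<open>The generators of the single coordinates are closed under intersection, so independence
  passes to the sigma-algebras generated by disjoint blocks.\<close>

lemma indep_sets_info:
  assumes "disjoint_family_on K J" and "\<And>j. j \<in> J \<Longrightarrow> K j \<subseteq> indices"
  shows "indep_sets (\<lambda>j. sets (info (K j))) J"
  unfolding sets_info
proof (rule indep_sets_collect_sigma)
  show "indep_sets coord (\<Union>j\<in>J. K j)"
    by (rule indep_sets_mono_index[OF _ independence[folded coord_def indices_def]]) (use assms in auto)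
qed (auto simp: Int_stable_coord assms)

text \<open>Independence of a family with the single block \<open>K\<close> already contains that
  its members are events.\<close>

lemma sets_info_events: "K \<subseteq> indices \<Longrightarrow> A \<in> sets (info K) \<Longrightarrow> A \<in> events"
  using indep_sets_info[of "\<lambda>_. K" "{()}"]
  by (auto simp: indep_sets_def disjoint_family_on_def)

lemma emeasure_Int_info:
  assumes "K \<inter> L = {}" "K \<subseteq> indices" "L \<subseteq> indices" "A \<in> sets (info K)" "B \<in> sets (info L)"
  shows "emeasure M (A \<inter> B) = emeasure M A * emeasure M B"
proof -
  have "indep_sets (\<lambda>j. sets (info (case_bool K L j))) UNIV"
    by (rule indep_sets_info) (use assms in \<open>auto simp: disjoint_family_on_def split: bool.splits\<close>)
  then have "indep_sets (case_bool (sets (info K)) (sets (info L))) UNIV"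
    by (rule indep_sets_mono_sets) (auto split: bool.splits)
  then have "indep_set (sets (info K)) (sets (info L))"
    by (simp add: indep_set_def)
  from indep_setD[OF this assms(4,5)] show ?thesis
    by (simp add: emeasure_eq_measure ennreal_mult)
qed

lemma nn_integral_N: "(\<integral>\<^sup>+\<omega>. f (N v \<omega>) \<partial>M) = (\<integral>\<^sup>+k. f k \<partial>measure_pmf Z)"
  by (subst N_distr[of v, symmetric], subst nn_integral_distr[OF N_measurable]) auto

lemma nn_integral_eta:
  "v \<noteq> [] \<Longrightarrow> f \<in> borel_measurable borel \<Longrightarrow> (\<integral>\<^sup>+\<omega>. f (\<eta> v \<omega>) \<partial>M) = (\<integral>\<^sup>+y. f y \<partial>Y)"
  by (subst \<eta>_distr[of v, symmetric], simp, subst nn_integral_distr[OF \<eta>_measurable]) auto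

lemma nn_integral_prod_coord:
  fixes g :: "nat list + nat list \<Rightarrow> 'w \<Rightarrow> ennreal"
  assumes I: "finite I" "I \<subseteq> indices" and g: "\<And>i. i \<in> I \<Longrightarrow> g i \<in> borel_measurable (info {i})"
  shows "(\<integral>\<^sup>+\<omega>. (\<Prod>i\<in>I. g i \<omega>) \<partial>M) = (\<Prod>i\<in>I. \<integral>\<^sup>+\<omega>. g i \<omega> \<partial>M)"
proof (rule indep_vars_nn_integral[OF I(1)])
  have 1: "g i -` A \<inter> space M \<in> sets (info {i})" if "i \<in> I" "A \<in> sets borel" for i A
    using measurable_sets[OF g that(2)] that(1) by simp
  have "indep_sets (\<lambda>j. sets (info {j})) I"
    by (rule indep_sets_info) (use I in \<open>auto simp: disjoint_family_on_def\<close>)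
  then have "indep_sets (\<lambda>i. {g i -` A \<inter> space M | A. A \<in> sets borel}) I"
    by (rule indep_sets_mono_sets) (use 1 in auto)
  moreover have "random_variable borel (g i)" if "i \<in> I" for i
    by (rule measurableI) (use 1[OF that] sets_info_events[of "{i}"] that I in auto)
  ultimately show "indep_vars (\<lambda>_. borel) g I"
    unfolding indep_vars_def2 by auto
qed simp

text \<open>Both membership of \<open>v\<close> in the tree and the reward are products over
  prefixes of \<open>v\<close>, each factor depending on one coordinate. Offspring numbers enter at
  levels 0 to \<open>n - 1\<close>, increments at levels 1 to \<open>n\<close>.\<close>

lemma nn_integral_vertex:
  assumes "n = length v" and g: "\<And>i. g i \<in> borel_measurable borel"
  shows "(\<integral>\<^sup>+\<omega>. indicator (gw_tree (\<lambda>v. N v \<omega>)) v * (\<Prod>i\<in>{1..n}. g i (\<eta> (take i v) \<omega>)) \<partial>M)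
    = (\<Prod>i<n. emeasure (measure_pmf Z) {v ! i<..}) * (\<Prod>i\<in>{1..n}. \<integral>\<^sup>+y. g i y \<partial>Y)"
proof -
  let ?A = "Inl ` ((\<lambda>i. take i v) ` {..<n}) :: (nat list + nat list) set"
  let ?B = "Inr ` ((\<lambda>i. take i v) ` {1..n}) :: (nat list + nat list) set"
  \<comment> \<open>Prefixes of \<open>v\<close> have different lengths, so a label reveals its own
    level through its length.\<close>
  define h where "h = case_sum (\<lambda>u \<omega>. indicator {v ! length u<..} (N u \<omega>)) (\<lambda>u \<omega>. g (length u) (\<eta> u \<omega>))"
  have injA: "inj_on (\<lambda>i. take i v) {..<n}" "inj_on (\<lambda>i. take i v) {1..n}"
    by (auto intro!: inj_on_inverseI[of _ length] simp: assms(1))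
  have fin: "finite (?A \<union> ?B)" and dis: "?A \<inter> ?B = {}" and sub: "?A \<union> ?B \<subseteq> indices"
    by (auto simp: indices_def assms(1))
  have prod: "(\<Prod>j\<in>?A \<union> ?B. F j) = (\<Prod>i<n. F (Inl (take i v))) * (\<Prod>i\<in>{1..n}. F (Inr (take i v)))"
    for F :: "_ \<Rightarrow> ennreal"
    using dis by (subst prod.union_disjoint) (simp_all add: prod.reindex injA del: One_nat_def)
  have tree: "indicator (gw_tree (\<lambda>v. N v \<omega>)) v = (\<Prod>i<n. indicator {v ! i<..} (N (take i v) \<omega>) :: ennreal)" for \<omega>
    by (cases "v \<in> gw_tree (\<lambda>v. N v \<omega>)") (auto simp: gw_tree_def assms(1) intro!: prod_zero[symmetric] bexI)
  have "(\<integral>\<^sup>+\<omega>. indicator (gw_tree (\<lambda>v. N v \<omega>)) v * (\<Prod>i\<in>{1..n}. g i (\<eta> (take i v) \<omega>)) \<partial>M)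
      = (\<integral>\<^sup>+\<omega>. (\<Prod>j\<in>?A \<union> ?B. h j \<omega>) \<partial>M)"
    unfolding prod tree by (intro nn_integral_cong arg_cong2[of _ _ _ _ "(*)"] prod.cong)
      (auto simp: h_def assms(1))
  also have "\<dots> = (\<Prod>j\<in>?A \<union> ?B. \<integral>\<^sup>+\<omega>. h j \<omega> \<partial>M)"
  proof (rule nn_integral_prod_coord[OF fin sub])
    fix j assume "j \<in> ?A \<union> ?B"
    then show "h j \<in> borel_measurable (info {j})"
      by (auto simp: h_def intro!: measurable_compose[OF measurable_info_N] measurable_compose[OF measurable_info_eta] g)
  qed
  also have "\<dots> = (\<Prod>i<n. emeasure (measure_pmf Z) {v ! i<..}) * (\<Prod>i\<in>{1..n}. \<integral>\<^sup>+y. g i y \<partial>Y)"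
    unfolding prod
  proof (intro arg_cong2[of _ _ _ _ "(*)"] prod.cong refl)
    fix i assume i: "i \<in> {1..n}"
    have "take i v \<noteq> []" using i assms(1) by auto
    then show "(\<integral>\<^sup>+\<omega>. h (Inr (take i v)) \<omega> \<partial>M) = (\<integral>\<^sup>+y. g i y \<partial>Y)"
      using i assms(1) by (simp add: h_def nn_integral_eta g)
  next
    fix i assume "i \<in> {..<n}"
    then show "(\<integral>\<^sup>+\<omega>. h (Inl (take i v)) \<omega> \<partial>M) = emeasure (measure_pmf Z) {v ! i<..}"
      using assms(1) by (simp add: h_def nn_integral_N)
  qed
  finally show ?thesis .
qed

end

section \<open>Summation over all labels of one level\<close>

lemma nn_integral_count_space_Cons:
  "(\<integral>\<^sup>+v. f v \<partial>count_space {v::nat list. length v = Suc n})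
    = (\<integral>\<^sup>+i. \<integral>\<^sup>+w. f (i # w) \<partial>count_space {w. length w = n} \<partial>count_space UNIV)"
proof -
  have 1: "(\<integral>\<^sup>+w. F w \<partial>count_space A) = (\<integral>\<^sup>+w. F w * indicator A w \<partial>count_space UNIV)" for A and F :: "nat list \<Rightarrow> ennreal"
    by (rule nn_integral_count_space_indicator) simp
  have "bij_betw (\<lambda>(i, w). i # w) (UNIV \<times> {w. length w = n}) {v::nat list. length v = Suc n}"
    by (auto simp: bij_betw_def inj_on_def length_Suc_conv image_iff)
  then have "(\<integral>\<^sup>+v. f v \<partial>count_space {v::nat list. length v = Suc n})
     = (\<integral>\<^sup>+x. f (fst x # snd x) \<partial>count_space (UNIV \<times> {w. length w = n}))"
    by (subst nn_integral_bij_count_space[symmetric]) (auto simp: case_prod_unfold)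
  also have "\<dots> = (\<integral>\<^sup>+x. f (fst x # snd x) * indicator (UNIV \<times> {w. length w = n}) x \<partial>count_space UNIV)"
    by (rule nn_integral_count_space_indicator) simp
  also have "\<dots> = (\<integral>\<^sup>+i. \<integral>\<^sup>+w. f (i # w) * indicator {w. length w = n} w \<partial>count_space UNIV \<partial>count_space UNIV)"
    by (subst nn_integral_fst_count_space[symmetric]) (auto simp: indicator_def)
  also have "\<dots> = (\<integral>\<^sup>+i. \<integral>\<^sup>+w. f (i # w) \<partial>count_space {w. length w = n} \<partial>count_space UNIV)"
    by (intro nn_integral_cong 1[symmetric])
  finally show ?thesis .
qed

text \<open>Distributivity: the head of the list is summed independently of the rest, giving one
  factor per position.\<close>

lemma nn_integral_prod_lists:
  fixes a :: "nat \<Rightarrow> ennreal"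
  shows "(\<integral>\<^sup>+v. (\<Prod>i<n. a (v ! i)) \<partial>count_space {v. length v = n}) = (\<Sum>k. a k) ^ n"
proof (induction n)
  case 0
  have "{v::nat list. length v = 0} = {[]}" by auto
  then show ?case by (simp add: nn_integral_count_space_finite)
next
  case (Suc n)
  have "(\<integral>\<^sup>+v. (\<Prod>i<Suc n. a (v ! i)) \<partial>count_space {v. length v = Suc n})
     = (\<integral>\<^sup>+k. \<integral>\<^sup>+w. a k * (\<Prod>i<n. a (w ! i)) \<partial>count_space {w. length w = n} \<partial>count_space UNIV)"
    unfolding nn_integral_count_space_Cons by (simp add: prod.lessThan_Suc_shift del: prod.lessThan_Suc)
  also have "\<dots> = (\<integral>\<^sup>+k. a k * (\<Sum>k. a k) ^ n \<partial>count_space UNIV)"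
    by (simp add: nn_integral_cmult Suc)
  also have "\<dots> = (\<Sum>k. a k) * (\<Sum>k. a k) ^ n"
    by (simp add: nn_integral_count_space_nat)
  finally show ?case by simp
qed

lemma suminf_pmf_tail:
  assumes "integrable (measure_pmf Z) (real :: nat \<Rightarrow> real)"
  shows "(\<Sum>k. emeasure (measure_pmf Z) {k<..}) = ennreal (measure_pmf.expectation Z real)"
proof -
  have "(\<Sum>k. emeasure (measure_pmf Z) {k<..}) = (\<integral>\<^sup>+k. of_nat k \<partial>measure_pmf Z)"
    by (subst nn_integral_nat_function) (auto simp: greaterThan_def)
  also have "\<dots> = ennreal (measure_pmf.expectation Z real)"
    by (subst nn_integral_eq_integral[symmetric, OF assms])
      (auto simp: ennreal_of_nat_eq_real_of_nat intro!: nn_integral_cong)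
  finally show ?thesis .
qed

text \<open>The increment integrals do not depend on the label. What remains is a sum over labels of
  products of \<open>P(Z > v ! i)\<close>, which is the \<open>n\<close>-th power of the sum of all
  tail probabilities, that is \<open>m ^ n\<close>.\<close>

lemma (in dbrw_environment) many_to_one:
  assumes "integrable (measure_pmf Z) real" "m = measure_pmf.expectation Z real"
    and g: "\<And>i. g i \<in> borel_measurable borel"
  shows "(\<integral>\<^sup>+\<omega>. \<integral>\<^sup>+v. indicator (gw_tree (\<lambda>v. N v \<omega>)) v * (\<Prod>i\<in>{1..n}. g i (\<eta> (take i v) \<omega>))
      \<partial>count_space {v. length v = n} \<partial>M) = ennreal m ^ n * (\<Prod>i\<in>{1..n}. \<integral>\<^sup>+y. g i y \<partial>Y)"
proof -
  have meas: "(\<lambda>\<omega>. indicator (gw_tree (\<lambda>v. N v \<omega>)) v * (\<Prod>i\<in>{1..n}. g i (\<eta> (take i v) \<omega>))) \<in> borel_measurable M"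
    if "length v = n" for v
  proof -
    have [measurable]: "N u \<in> measurable M (count_space UNIV)" for u by (rule N_measurable)
    have "Measurable.pred M (\<lambda>\<omega>. v \<in> gw_tree (\<lambda>v. N v \<omega>))"
      unfolding gw_tree_def mem_Collect_eq by measurable
    moreover have "(\<lambda>\<omega>. g i (\<eta> (take i v) \<omega>)) \<in> borel_measurable M" if "i \<in> {1..n}" for i
      by (rule measurable_compose[OF \<eta>_measurable g]) (use that \<open>length v = n\<close> in auto)
    ultimately show ?thesis
      by (intro borel_measurable_times_ennreal borel_measurable_prod_ennreal)
         (auto simp: indicator_def intro!: measurable_If)
  qed
  show ?thesis
    apply (subst nn_integral_count_space_nn_integral)
      apply (simp)
     apply (use meas in blast)
    apply (subst nn_integral_cong[OF nn_integral_vertex])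
      apply simp
     apply (rule g)
    apply (simp add: nn_integral_multc nn_integral_prod_lists[of _ "\<lambda>k. emeasure (measure_pmf Z) {k<..}"]
        suminf_pmf_tail assms(1,2))
    done
qed

subsection \<open>Tail sums and layered series\<close>

text \<open>A geometric sum is at most \<open>m / (m - 1)\<close> times its largest term, and that
  term is below \<open>a\<close>.\<close>

lemma sum_powers_below:
  fixes m a :: real
  assumes "m > 1" "a \<ge> 0"
  shows "(\<Sum>n<L. if m ^ n < a then m ^ n else 0) \<le> m / (m - 1) * a"
proof (induction L)
  case 0
  then show ?case using assms by simp
next
  case (Suc L)
  show ?case
  proof (cases "m ^ L < a")
    case True
    have "(\<Sum>n<Suc L. if m ^ n < a then m ^ n else 0) \<le> (\<Sum>n<Suc L. m ^ n)"
      by (intro sum_mono) (use assms in auto)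
    also have "\<dots> = (m ^ Suc L - 1) / (m - 1)"
      using assms by (intro geometric_sum) simp
    also have "\<dots> \<le> m * a / (m - 1)"
    proof (rule divide_right_mono)
      have "m * m ^ L \<le> m * a" using assms True by (intro mult_left_mono) auto
      then show "m ^ Suc L - 1 \<le> m * a" unfolding power_Suc by linarith
    qed (use assms in simp)
    finally show ?thesis by simp
  qed (use Suc in simp)
qed

text \<open>Taking the power \<open>1 / H\<close> turns the threshold at level \<open>n\<close> into
  the population size \<open>m ^ n\<close>; this is where the moment of order \<open>1 / H\<close>
  comes from.\<close>

lemma powr_less_abs_iff:
  fixes m H y K :: real
  assumes "m > 1" "H > 0" "K > 0"
  shows "K * m powr (real n * H) < \<bar>y\<bar> \<longleftrightarrow> m ^ n < (\<bar>y\<bar> / K) powr (1 / H)"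
proof -
  have "K * m powr (real n * H) < \<bar>y\<bar> \<longleftrightarrow> m powr (real n * H) < \<bar>y\<bar> / K"
    using assms by (simp add: field_simps)
  also have "\<dots> \<longleftrightarrow> (m powr (real n * H)) powr (1 / H) < (\<bar>y\<bar> / K) powr (1 / H)"
    using assms powr_less_mono2[of "1 / H" "m powr (real n * H)" "\<bar>y\<bar> / K"]
      powr_mono2[of "1 / H" "\<bar>y\<bar> / K" "m powr (real n * H)"] by (intro iffI) (simp, force simp: not_less)
  also have "(m powr (real n * H)) powr (1 / H) = m ^ n"
    using assms by (simp add: powr_powr powr_realpow)
  finally show ?thesis .
qed

text \<open>By Tonelli the series is the expectation of the sum of all \<open>m ^ n\<close> below
  \<open>\<bar>Y\<bar> powr (1 / H)\<close>, which is at most a constant times that bound.\<close>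

lemma summable_tails:
  assumes "m > 1" "H > 0" "real_distribution Y"
    and "(\<integral>\<^sup>+y. ennreal (\<bar>y\<bar> powr (1 / H)) \<partial>Y) < \<infinity>"
  shows "summable (\<lambda>n. m ^ n * measure Y {y. m powr (real n * H) < \<bar>y\<bar>})"
proof (rule summable_suminf_not_top)
  interpret real_distribution Y by fact
  let ?E = "\<lambda>n. {y. m powr (real n * H) < \<bar>y\<bar>}"
  have E: "?E n \<in> sets Y" for n
    using events_eq_borel by simp
  have "(\<Sum>n. ennreal (m ^ n * measure Y (?E n))) = (\<Sum>n. \<integral>\<^sup>+y. ennreal (m ^ n) * indicator (?E n) y \<partial>Y)"
    using E assms(1) by (intro suminf_cong) (simp add: nn_integral_cmult_indicator emeasure_eq_measure ennreal_mult)
  also have "\<dots> = (\<integral>\<^sup>+y. (\<Sum>n. ennreal (m ^ n) * indicator (?E n) y) \<partial>Y)"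
    using E by (intro nn_integral_suminf[symmetric]) simp
  also have "\<dots> \<le> (\<integral>\<^sup>+y. ennreal (m / (m - 1)) * ennreal (\<bar>y\<bar> powr (1 / H)) \<partial>Y)"
  proof (intro nn_integral_mono suminf_le_const summableI)
    fix y L
    have "(\<Sum>n<L. ennreal (m ^ n) * indicator (?E n) y)
        = ennreal (\<Sum>n<L. if m ^ n < \<bar>y\<bar> powr (1 / H) then m ^ n else 0)"
    proof -
      have "ennreal (m ^ n) * indicator (?E n) y = ennreal (if m ^ n < \<bar>y\<bar> powr (1 / H) then m ^ n else 0)" for n
        using powr_less_abs_iff[OF assms(1,2), of 1 n y] by (simp add: indicator_def)
      then show ?thesis
        using assms(1) by (simp only:) (intro sum_ennreal, simp)
    qed
    also have "\<dots> \<le> ennreal (m / (m - 1) * \<bar>y\<bar> powr (1 / H))"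
      using assms(1) by (intro ennreal_leI sum_powers_below) auto
    also have "\<dots> = ennreal (m / (m - 1)) * ennreal (\<bar>y\<bar> powr (1 / H))"
      by (rule ennreal_mult'') simp
    finally show "(\<Sum>n<L. ennreal (m ^ n) * indicator (?E n) y) \<le> ennreal (m / (m - 1)) * ennreal (\<bar>y\<bar> powr (1 / H))" .
  qed
  also have "\<dots> < top"
    using assms by (subst nn_integral_cmult) (auto simp: ennreal_mult_less_top)
  finally show "(\<Sum>n. ennreal (m ^ n * measure Y (?E n))) \<noteq> top" by simp
qed (use assms in simp)

text \<open>Conversely, up to a constant, \<open>\<bar>y\<bar> powr (1 / H)\<close> is bounded by
  one plus the sum of the powers of \<open>m\<close> below it, so a convergent series would make the
  moment finite.\<close>

lemma not_summable_tails:
  assumes "m > 1" "H > 0" "K > 0" "real_distribution Y"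
    and "(\<integral>\<^sup>+y. ennreal (\<bar>y\<bar> powr (1 / H)) \<partial>Y) = \<infinity>"
  shows "\<not> summable (\<lambda>n. m ^ n * measure Y {y. K * m powr (real n * H) < \<bar>y\<bar>})"
proof
  interpret real_distribution Y by fact
  let ?E = "\<lambda>n. {y. K * m powr (real n * H) < \<bar>y\<bar>}"
  assume summable: "summable (\<lambda>n. m ^ n * measure Y (?E n))"
  have E: "?E n \<in> sets Y" for n
    using events_eq_borel by simp
  have bound: "ennreal (\<bar>y\<bar> powr (1 / H)) \<le> ennreal (K powr (1 / H) * m) * (1 + (\<Sum>n. ennreal (m ^ n) * indicator (?E n) y))"
    for y
  proof -
    let ?a = "(\<bar>y\<bar> / K) powr (1 / H)"
    have y: "\<bar>y\<bar> powr (1 / H) = K powr (1 / H) * ?a"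
      using assms by (simp add: powr_divide)
    have "ennreal ?a \<le> ennreal m * (1 + (\<Sum>n. ennreal (m ^ n) * indicator (?E n) y))"
    proof (cases "?a \<le> m")
      case True
      then have "ennreal ?a \<le> ennreal m * 1" by (simp add: ennreal_leI)
      also have "\<dots> \<le> ennreal m * (1 + (\<Sum>n. ennreal (m ^ n) * indicator (?E n) y))"
        by (intro mult_left_mono) auto
      finally show ?thesis .
    next
      case False
      \<comment> \<open>The power just before the first one to reach \<open>?a\<close> lies below
        \<open>?a\<close>, but is short of it by a factor of at most \<open>m\<close>.\<close>
      define j where "j = (LEAST j. ?a \<le> m ^ j)"
      have ex: "\<exists>j. ?a \<le> m ^ j"
        using real_arch_pow[OF assms(1), of ?a] by (auto intro: less_imp_le)
      then have j: "?a \<le> m ^ j"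
        unfolding j_def by (rule LeastI_ex)
      with False assms(1) have "j \<noteq> 0"
        by (intro notI) simp
      then obtain i where i: "j = Suc i" using not0_implies_Suc by blast
      have "m ^ i < ?a"
        using not_less_Least[of i "\<lambda>j. ?a \<le> m ^ j"] i unfolding j_def[symmetric] by simp
      then have y: "y \<in> ?E i"
        using powr_less_abs_iff[OF assms(1-3)] by simp
      have "ennreal ?a \<le> ennreal (m * m ^ i)"
        using j i by (simp add: ennreal_leI)
      also have "\<dots> = ennreal m * (\<Sum>n\<in>{i}. ennreal (m ^ n) * indicator (?E n) y)"
        using y assms(1) by (simp add: ennreal_mult)
      also have "\<dots> \<le> ennreal m * (\<Sum>n. ennreal (m ^ n) * indicator (?E n) y)"
        by (intro mult_left_mono sum_le_suminf) auto
      also have "\<dots> \<le> ennreal m * (1 + (\<Sum>n. ennreal (m ^ n) * indicator (?E n) y))"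
        by (intro mult_left_mono) auto
      finally show ?thesis .
    qed
    then show ?thesis
      unfolding y using assms by (simp add: ennreal_mult'' mult.assoc mult_left_mono)
  qed
  have "\<infinity> \<le> (\<integral>\<^sup>+y. ennreal (K powr (1 / H) * m) * (1 + (\<Sum>n. ennreal (m ^ n) * indicator (?E n) y)) \<partial>Y)"
    unfolding assms(5)[symmetric] by (intro nn_integral_mono bound)
  also have "\<dots> = ennreal (K powr (1 / H) * m) * (1 + (\<Sum>n. ennreal (m ^ n * measure Y (?E n))))"
    using E assms(1) by (subst nn_integral_cmult, simp, subst nn_integral_add, simp, simp, subst nn_integral_suminf)
      (simp_all add: nn_integral_cmult_indicator emeasure_eq_measure ennreal_mult prob_space[unfolded space_eq_univ])
  also have "\<dots> < \<infinity>"
    using summable assms(1) by (simp add: ennreal_mult_eq_top_iff suminf_ennreal2 less_top[symmetric])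
  finally show False by simp
qed

text \<open>At most \<open>c * k0\<close> terms exceed \<open>2 ^ - k0\<close>, each at most
  \<open>A\<close>. Every other positive term lies between two consecutive powers of
  \<open>1/2\<close> and is charged the upper one; the number of terms per layer grows only
  linearly.\<close>

lemma layered_sum_bound:
  fixes x :: "nat \<Rightarrow> real"
  assumes x: "\<And>n. 0 \<le> x n" "\<And>n. x n \<le> A"
    and layer: "\<And>k. k \<ge> k0 \<Longrightarrow> finite {n. (1/2) ^ k < x n} \<and> card {n. (1/2) ^ k < x n} \<le> c * k"
  shows "(\<Sum>n<L. x n) \<le> A * real (c * k0) + (\<Sum>k. (1/2) ^ (k0 + k) * real (c * Suc (k0 + k)))"
proof -
  \<comment> \<open>Only the lower end of the layer is tested. The layers overlap, which does no
    harm, since the count hypothesis concerns all terms above a threshold.\<close>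
  define f where "f k n = (if (1/2) ^ Suc (k0 + k) < x n then (1/2) ^ (k0 + k) else 0 :: real)" for k n
  have A: "0 \<le> A" using order_trans[OF x(1) x(2)[of 0]] .
  have f0: "0 \<le> f k n" for k n by (simp add: f_def)
  have summable_f: "summable (\<lambda>k. f k n)" for n
  proof (rule summable_comparison_test)
    show "\<exists>N. \<forall>k\<ge>N. norm (f k n) \<le> (1/2) ^ k"
      by (auto simp: f_def power_add intro!: exI[of _ 0] mult_left_le_one_le power_le_one)
  qed (simp add: summable_geometric)
  have card_le: "(\<Sum>n<L. if (1/2) ^ k < x n then b else 0) \<le> b * real (c * k)" if "k \<ge> k0" "b \<ge> 0" for b :: real and k
  proof -
    have "(\<Sum>n<L. if (1/2) ^ k < x n then b else 0) = b * real (card ({..<L} \<inter> {n. (1/2) ^ k < x n}))"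
      by (simp add: sum.If_cases)
    also have "\<dots> \<le> b * real (c * k)"
      using layer[OF that(1)] card_mono[of "{n. (1/2) ^ k < x n}" "{..<L} \<inter> {n. (1/2) ^ k < x n}"] that(2)
      by (intro mult_left_mono) (simp_all del: of_nat_mult)
    finally show ?thesis .
  qed
  have pt: "x n \<le> (if (1/2) ^ k0 < x n then A else 0) + (\<Sum>k. f k n)" for n
  proof (cases "(1/2) ^ k0 < x n \<or> x n = 0")
    case True
    then show ?thesis
      using x(2)[of n] suminf_nonneg[OF summable_f f0, of n] A by (auto simp: add_nonneg_nonneg add_increasing2)
  next
    case False
    with x(1)[of n] have pos: "0 < x n" "x n \<le> (1/2) ^ k0" by auto
    define k where "k = (LEAST k. (1/2) ^ k < x n)"
    have "\<exists>k. (1/2) ^ k < x n" using real_arch_pow_inv[OF pos(1), of "1/2"] by simp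
    then have k: "(1/2) ^ k < x n" unfolding k_def by (rule LeastI_ex)
    have "k > k0"
    proof (rule ccontr)
      assume "\<not> k > k0"
      then have "(1/2::real) ^ k0 \<le> (1/2) ^ k" by (intro power_decreasing) auto
      with k pos(2) show False by simp
    qed
    then obtain i where i: "k = Suc (k0 + i)" using less_iff_Suc_add by auto
    have "x n \<le> (1/2) ^ (k0 + i)"
      using not_less_Least[of "k0 + i" "\<lambda>k. (1/2) ^ k < x n"] i unfolding k_def[symmetric] by simp
    also have "\<dots> = (\<Sum>k\<in>{i}. f k n)" using k i by (simp add: f_def)
    also have "\<dots> \<le> (\<Sum>k. f k n)" by (intro sum_le_suminf summable_f) (auto simp: f0)
    finally show ?thesis using A by simp
  qed
  have summable_B: "summable (\<lambda>k. (1/2) ^ (k0 + k) * real (c * Suc (k0 + k)))"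
  proof -
    \<comment> \<open>\<open>diffs (\<lambda>_. 1) k\<close> is \<open>Suc k\<close>: this is the
      derivative of the geometric series.\<close>
    have "summable (\<lambda>k. real c * (diffs (\<lambda>_. 1) k * (1/2::real) ^ k))"
      by (intro summable_mult termdiff_converges[where K = 1]) (auto simp: summable_geometric)
    also have "(\<lambda>k. real c * (diffs (\<lambda>_. 1) k * (1/2::real) ^ k)) = (\<lambda>k. (1/2) ^ k * real (c * Suc k))"
      by (simp add: diffs_def fun_eq_iff algebra_simps)
    finally have "summable (\<lambda>k. (1/2::real) ^ k * real (c * Suc k))" .
    from summable_ignore_initial_segment[OF this, of k0] show ?thesis
      by (simp add: add.commute)
  qed
  have "(\<Sum>n<L. x n) \<le> (\<Sum>n<L. if (1/2) ^ k0 < x n then A else 0) + (\<Sum>n<L. \<Sum>k. f k n)"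
    unfolding sum.distrib[symmetric] by (intro sum_mono pt)
  also have "(\<Sum>n<L. \<Sum>k. f k n) = (\<Sum>k. \<Sum>n<L. f k n)"
    by (intro suminf_sum[symmetric] summable_f)
  also have "\<dots> \<le> (\<Sum>k. (1/2) ^ (k0 + k) * real (c * Suc (k0 + k)))"
  proof (intro suminf_le)
    show "summable (\<lambda>k. \<Sum>n<L. f k n)" by (intro summable_sum summable_f)
    show "(\<Sum>n<L. f k n) \<le> (1/2) ^ (k0 + k) * real (c * Suc (k0 + k))" for k
      unfolding f_def by (intro card_le) auto
  qed (fact summable_B)
  finally show ?thesis using card_le[of k0 A] A by simp
qed

subsection \<open>Finite moment: counting exceedances along rays\<close>

lemma borel_measurable_nn_integral_countable:
  fixes f :: "'i \<Rightarrow> 'a \<Rightarrow> ennreal"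
  assumes "countable I" and "\<And>i. i \<in> I \<Longrightarrow> f i \<in> borel_measurable M"
  shows "(\<lambda>x. \<integral>\<^sup>+i. f i x \<partial>count_space I) \<in> borel_measurable M"
proof -
  interpret sigma_finite_measure "count_space I"
    by (rule sigma_finite_measure_count_space_countable) fact
  have "(\<lambda>x. f (snd x) (fst x)) \<in> borel_measurable (M \<Otimes>\<^sub>M count_space I)"
    by (rule measurable_compose_countable'[where f="\<lambda>i x. f i (fst x)" and g=snd and I=I])
       (use assms in \<open>auto intro!: measurable_compose[OF measurable_fst]\<close>)
  then have "(\<lambda>(x, i). f i x) \<in> borel_measurable (M \<Otimes>\<^sub>M count_space I)"
    by (simp add: case_prod_unfold)
  then show ?thesis by (rule borel_measurable_nn_integral)
qed

text \<open>A first-moment Borel--Cantelli argument: the sum has finite expectation, hence is almost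
  surely finite, and its terms tend to 0.\<close>

lemma AE_eventually_less_one:
  fixes G :: "nat \<Rightarrow> 'a \<Rightarrow> ennreal"
  assumes [measurable]: "\<And>k. G k \<in> borel_measurable M" and "(\<Sum>k. \<integral>\<^sup>+x. G k x \<partial>M) < \<infinity>"
  shows "AE x in M. \<forall>\<^sub>F k in sequentially. G k x < 1"
proof -
  have "AE x in M. (\<Sum>k. G k x) \<noteq> \<infinity>"
    using assms(2) by (intro nn_integral_PInf_AE) (simp_all add: nn_integral_suminf less_top)
  then show ?thesis
  proof eventually_elim
    case (elim x)
    then have fin: "G k x \<noteq> \<infinity>" for k
      using sum_le_suminf[of "\<lambda>k. G k x" "{k}"] by (auto simp: top_unique)
    have "summable (\<lambda>k. enn2real (G k x))"
      using elim fin by (intro summable_suminf_not_top) (auto simp: less_top)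
    then have "(\<lambda>k. enn2real (G k x)) \<longlonglongrightarrow> 0" by (rule summable_LIMSEQ_zero)
    then have "\<forall>\<^sub>F k in sequentially. enn2real (G k x) < 1" by (rule order_tendstoD) simp
    then show ?case
      using fin by (auto elim!: eventually_mono simp: enn2real_less_iff less_top[symmetric])
  qed
qed

lemma finite_gw_level: "finite {v \<in> gw_tree T. length v = n}"
proof (induction n)
  case (Suc n)
  have "{v \<in> gw_tree T. length v = Suc n} \<subseteq> (\<Union>u\<in>{v \<in> gw_tree T. length v = n}. (\<lambda>i. u @ [i]) ` {..<T u})"
  proof
    fix v assume "v \<in> {v \<in> gw_tree T. length v = Suc n}"
    then have v: "v \<in> gw_tree T" "length v = Suc n" by auto
    then have "v = take n v @ [v ! n]"
      by (metis lessI take_Suc_conv_app_nth take_all_iff order_refl)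
    moreover have "take n v \<in> gw_tree T" "v ! n < T (take n v)"
      using v by (auto simp: gw_tree_def min_def)
    ultimately show "v \<in> (\<Union>u\<in>{v \<in> gw_tree T. length v = n}. (\<lambda>i. u @ [i]) ` {..<T u})"
      using v(2) by (auto intro!: bexI[of _ "take n v"] image_eqI[of _ _ "v ! n"])
  qed
  then show ?case by (rule finite_subset) (use Suc in auto)
qed simp

lemma Icc_1_eq_insert: "{1..n} = insert n {1..<n}" if "0 < n" for n :: nat
  using that by auto

locale finite_moment_dbrw = dbrw_environment M Z Y N \<eta>
  for M :: "'w measure" and Z Y N \<eta> +
  fixes H m :: real
  assumes H_pos: "H > 0" and m_gt_1: "m > 1"
    and Z_integrable: "integrable (measure_pmf Z) real"
    and m_eq: "m = measure_pmf.expectation Z real"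
    and Y_distribution: "real_distribution Y"
    and moment: "(\<integral>\<^sup>+y. ennreal (\<bar>y\<bar> powr (1 / H)) \<partial>Y) < \<infinity>"
begin

sublocale Y: real_distribution Y by (rule Y_distribution)

definition tail :: "nat \<Rightarrow> real" where
  "tail n = measure Y {y. m powr (real n * H) < \<bar>y\<bar>}"

definition tail_mass :: real where
  "tail_mass = (\<Sum>n. m ^ n * tail n)"

lemma summable_tail: "summable (\<lambda>n. m ^ n * tail n)"
  unfolding tail_def by (rule summable_tails) (use H_pos m_gt_1 Y_distribution moment in auto)

lemma tail_nonneg: "0 \<le> tail n"
  by (simp add: tail_def)

lemma sum_tail_le: "finite J \<Longrightarrow> (\<Sum>j\<in>J. tail j) \<le> tail_mass"
proof -
  assume "finite J"
  have "(\<Sum>j\<in>J. tail j) \<le> (\<Sum>j\<in>J. m ^ j * tail j)"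
    using m_gt_1 mult_right_mono[OF one_le_power tail_nonneg] by (intro sum_mono) force
  also have "\<dots> \<le> tail_mass"
    unfolding tail_mass_def using \<open>finite J\<close> m_gt_1
    by (intro sum_le_suminf summable_tail) (auto simp: tail_nonneg)
  finally show ?thesis .
qed

text \<open>For an increment \<open>y\<close> at level \<open>i\<close>: its discounted absolute
  value is above \<open>2 ^ - k\<close>.\<close>

definition exceeds :: "nat \<Rightarrow> nat \<Rightarrow> real \<Rightarrow> bool" where
  "exceeds k i y \<longleftrightarrow> (1/2) ^ k * m powr (real i * H) < \<bar>y\<bar>"

text \<open>
  Beyond level \<open>layer_width * k\<close>, exceeding the threshold \<open>2 ^ - k\<close> at a level is at most as likely
  as exceeding the threshold 1 at that level minus \<open>layer_width * k\<close>.
\<close>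

definition layer_width :: nat where
  "layer_width = (SOME a. a > 0 \<and> 2 \<le> m powr (real a * H))"

lemma layer_width: "layer_width > 0" "2 \<le> m powr (real layer_width * H)"
proof -
  have "1 < m powr H" using m_gt_1 H_pos by simp
  from real_arch_pow[OF this] obtain n where n: "2 < (m powr H) ^ n" by blast
  then have "n > 0 \<and> 2 \<le> m powr (real n * H)"
    using m_gt_1 powr_power[of m H n] by (cases "n = 0") (auto simp: mult.commute)
  from someI[of "\<lambda>a. a > 0 \<and> 2 \<le> m powr (real a * H)", OF this] show "layer_width > 0" "2 \<le> m powr (real layer_width * H)"
    unfolding layer_width_def by auto
qed

lemma exceeds_measurable [measurable]: "Measurable.pred borel (exceeds k i)"
  unfolding exceeds_def by measurable

lemma exceeds_tail: "measure Y {y. exceeds k (layer_width * k + j) y} \<le> tail j"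
  unfolding tail_def
proof (rule Y.finite_measure_mono)
  have "m powr (real j * H) \<le> (1/2) ^ k * m powr (real (layer_width * k + j) * H)"
  proof -
    have "m powr (real (layer_width * k + j) * H) = (m powr (real layer_width * H)) ^ k * m powr (real j * H)"
      using m_gt_1 by (simp add: powr_add[symmetric] powr_powr powr_realpow[symmetric] algebra_simps)
    also have "\<dots> \<ge> 2 ^ k * m powr (real j * H)"
      using layer_width(2) by (intro mult_right_mono power_mono) auto
    finally show ?thesis by (simp add: power_divide field_simps)
  qed
  then show "{y. exceeds k (layer_width * k + j) y} \<subseteq> {y. m powr (real j * H) < \<bar>y\<bar>}"
    by (auto simp: exceeds_def)
qed (simp add: Y.events_eq_borel)

section \<open>Weighted counts of exceeding vertices\<close>

text \<open>
  Each exceedance among the ancestors is rewarded by \<open>2 * m ^ layer_width\<close>: this beats the expected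
  number of order \<open>m ^ (layer_width * k)\<close> of exceedances, so that \<open>k\<close> ancestors exceeding at once
  have probability of order \<open>2 ^ - k\<close>.
\<close>

definition weight :: "nat \<Rightarrow> nat \<Rightarrow> nat \<Rightarrow> real \<Rightarrow> ennreal" where
  "weight k n i y = (if i = n then if exceeds k i y then 1 else 0
     else if layer_width * k \<le> i \<and> exceeds k i y then ennreal (2 * m ^ layer_width) else 1)"

lemma weight_measurable [measurable]: "weight k n i \<in> borel_measurable borel"
  unfolding weight_def by measurable

text \<open>Counts the vertices of level \<open>n\<close> that exceed, each multiplied by one reward
  per exceeding proper ancestor from level \<open>layer_width * k\<close> on.\<close>

definition weighted_exceedances :: "nat \<Rightarrow> nat \<Rightarrow> 'w \<Rightarrow> ennreal" where
  "weighted_exceedances k n \<omega> = (\<integral>\<^sup>+v. indicator (gw_tree (\<lambda>v. N v \<omega>)) v *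
     (\<Prod>i\<in>{1..n}. weight k n i (\<eta> (take i v) \<omega>)) \<partial>count_space {v. length v = n})"

lemma indicator_gw_tree_measurable: "(\<lambda>\<omega>. indicator (gw_tree (\<lambda>v. N v \<omega>)) v :: ennreal) \<in> borel_measurable M"
proof -
  have [measurable]: "N u \<in> measurable M (count_space UNIV)" for u by (rule N_measurable)
  have "Measurable.pred M (\<lambda>\<omega>. v \<in> gw_tree (\<lambda>v. N v \<omega>))"
    unfolding gw_tree_def mem_Collect_eq by measurable
  then show ?thesis by (auto simp: indicator_def intro!: measurable_If)
qed

lemma weighted_exceedances_measurable [measurable]: "weighted_exceedances k n \<in> borel_measurable M"
  unfolding weighted_exceedances_def
  by (intro borel_measurable_nn_integral_countable borel_measurable_times_ennreal borel_measurable_prod_ennreal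
      indicator_gw_tree_measurable measurable_compose[OF \<eta>_measurable weight_measurable]) auto

lemma nn_integral_weight_end:
  "(\<integral>\<^sup>+y. weight k (layer_width * k + j) (layer_width * k + j) y \<partial>Y) \<le> ennreal (tail j)"
proof -
  have "(\<integral>\<^sup>+y. weight k (layer_width * k + j) (layer_width * k + j) y \<partial>Y) = (\<integral>\<^sup>+y. indicator {y. exceeds k (layer_width * k + j) y} y \<partial>Y)"
    by (intro nn_integral_cong) (auto simp: weight_def)
  also have "\<dots> = ennreal (measure Y {y. exceeds k (layer_width * k + j) y})"
    by (subst nn_integral_indicator) (auto simp: Y.events_eq_borel Y.emeasure_eq_measure)
  finally show ?thesis using exceeds_tail by (simp add: ennreal_leI)
qed

text \<open>The mean weight is at most 1 plus reward times tail. The exponential form turns the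
  product along a path into the exponential of a sum of tails, which stays bounded in the length of
  the path.\<close>

lemma nn_integral_weight:
  assumes "i \<noteq> n"
  shows "(\<integral>\<^sup>+y. weight k n i y \<partial>Y) \<le> ennreal (if layer_width * k \<le> i then exp (2 * m ^ layer_width * tail (i - layer_width * k)) else 1)"
proof (cases "layer_width * k \<le> i")
  case True
  let ?E = "{y. exceeds k i y}"
  have E: "?E \<in> sets Y" by (simp add: Y.events_eq_borel)
  have "(\<integral>\<^sup>+y. weight k n i y \<partial>Y) \<le> (\<integral>\<^sup>+y. 1 + ennreal (2 * m ^ layer_width) * indicator ?E y \<partial>Y)"
    using assms by (intro nn_integral_mono) (auto simp: weight_def)
  also have "\<dots> = 1 + ennreal (2 * m ^ layer_width) * ennreal (measure Y ?E)"
    using E by (subst nn_integral_add) (auto simp: Y.emeasure_eq_measure nn_integral_cmult_indicator Y.prob_space[unfolded Y.space_eq_univ])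
  also have "\<dots> = ennreal (1 + 2 * m ^ layer_width * measure Y ?E)"
    using m_gt_1 by (subst ennreal_plus) (auto simp: ennreal_mult)
  also have "\<dots> \<le> ennreal (1 + 2 * m ^ layer_width * tail (i - layer_width * k))"
    using exceeds_tail[of k "i - layer_width * k"] True m_gt_1 by (intro ennreal_leI add_left_mono mult_left_mono) auto
  also have "\<dots> \<le> ennreal (exp (2 * m ^ layer_width * tail (i - layer_width * k)))"
    by (intro ennreal_leI exp_ge_add_one_self)
  finally show ?thesis using True by simp
next
  case False
  then have "weight k n i = (\<lambda>_. 1)" using assms by (auto simp: weight_def)
  then show ?thesis using False by (simp add: Y.prob_space Y.emeasure_eq_measure)
qed

text \<open>By the many-to-one formula the end vertex contributes \<open>tail j\<close>, the path
  above it a bounded factor, and the population size splits as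
  \<open>m ^ (layer_width * k) * m ^ j\<close>. Positivity of the level places the end vertex in the
  product over \<open>{1..n}\<close>.\<close>

lemma nn_integral_weighted_exceedances:
  assumes "layer_width * k + j > 0"
  shows "(\<integral>\<^sup>+\<omega>. weighted_exceedances k (layer_width * k + j) \<omega> \<partial>M)
    \<le> ennreal (m ^ (layer_width * k) * exp (2 * m ^ layer_width * tail_mass) * (m ^ j * tail j))"
proof -
  let ?n = "layer_width * k + j" and ?c = "2 * m ^ layer_width"
  let ?h = "\<lambda>i. if layer_width * k \<le> i then exp (?c * tail (i - layer_width * k)) else 1"
  have "(\<Prod>i\<in>{1..<?n}. \<integral>\<^sup>+y. weight k ?n i y \<partial>Y) \<le> (\<Prod>i\<in>{1..<?n}. ennreal (?h i))"
    by (intro prod_mono_ennreal nn_integral_weight) auto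
  also have "\<dots> = ennreal (\<Prod>i\<in>{1..<?n}. ?h i)"
    by (rule prod_ennreal) auto
  also have "\<dots> \<le> ennreal (exp (?c * tail_mass))"
  proof (rule ennreal_leI)
    have "(\<Prod>i\<in>{1..<?n}. ?h i) = exp (\<Sum>i\<in>{1..<?n} \<inter> {i. layer_width * k \<le> i}. ?c * tail (i - layer_width * k))"
      by (simp add: exp_sum prod.If_cases)
    also have "(\<Sum>i\<in>{1..<?n} \<inter> {i. layer_width * k \<le> i}. ?c * tail (i - layer_width * k))
        = ?c * (\<Sum>i\<in>(\<lambda>i. i - layer_width * k) ` ({1..<?n} \<inter> {i. layer_width * k \<le> i}). tail i)"
      by (subst sum.reindex) (auto simp: inj_on_def sum_distrib_left)
    also have "\<dots> \<le> ?c * tail_mass"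
      using m_gt_1 by (intro mult_left_mono sum_tail_le) auto
    finally show "(\<Prod>i\<in>{1..<?n}. ?h i) \<le> exp (?c * tail_mass)" by simp
  qed
  finally have path: "(\<Prod>i\<in>{1..<?n}. \<integral>\<^sup>+y. weight k ?n i y \<partial>Y) \<le> ennreal (exp (?c * tail_mass))" .
  have "(\<integral>\<^sup>+\<omega>. weighted_exceedances k ?n \<omega> \<partial>M) = ennreal m ^ ?n * (\<Prod>i\<in>{1..?n}. \<integral>\<^sup>+y. weight k ?n i y \<partial>Y)"
    unfolding weighted_exceedances_def by (rule many_to_one[OF Z_integrable m_eq weight_measurable])
  also have "{1..?n} = insert ?n {1..<?n}"
    by (rule Icc_1_eq_insert[OF assms])
  also have "ennreal m ^ ?n * (\<Prod>i\<in>insert ?n {1..<?n}. \<integral>\<^sup>+y. weight k ?n i y \<partial>Y)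
     = ennreal m ^ ?n * ((\<integral>\<^sup>+y. weight k ?n ?n y \<partial>Y) * (\<Prod>i\<in>{1..<?n}. \<integral>\<^sup>+y. weight k ?n i y \<partial>Y))"
    by (subst prod.insert) auto
  also have "\<dots> \<le> ennreal m ^ ?n * (ennreal (tail j) * ennreal (exp (?c * tail_mass)))"
    by (intro mult_left_mono mult_mono nn_integral_weight_end path) (use assms in auto)
  also have "\<dots> = ennreal (m ^ (layer_width * k) * exp (?c * tail_mass) * (m ^ j * tail j))"
    using m_gt_1 tail_nonneg[of j] by (simp add: ennreal_power ennreal_mult[symmetric] power_add mult_ac)
  finally show ?thesis .
qed

text \<open>Normalised so that a single exceeding vertex with \<open>k\<close> exceeding ancestors,
  all from level \<open>layer_width * k\<close> on, contributes at least 1.\<close>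

definition layer_functional :: "nat \<Rightarrow> 'w \<Rightarrow> ennreal" where
  "layer_functional k \<omega> = (\<Sum>j. weighted_exceedances k (layer_width * k + j) \<omega>) * ennreal ((1 / (2 * m ^ layer_width)) ^ k)"

text \<open>Of the \<open>k\<close> rewards divided out, the factor \<open>m ^ layer_width\<close>
  cancels the population growth up to level \<open>layer_width * k\<close>, and the factor 2 leaves
  \<open>(1/2) ^ k\<close>.\<close>

lemma nn_integral_layer_functional:
  assumes "k > 0"
  shows "(\<integral>\<^sup>+\<omega>. layer_functional k \<omega> \<partial>M) \<le> ennreal (exp (2 * m ^ layer_width * tail_mass) * tail_mass * (1/2) ^ k)"
proof -
  let ?c = "m ^ (layer_width * k) * exp (2 * m ^ layer_width * tail_mass)"
  have "(\<integral>\<^sup>+\<omega>. layer_functional k \<omega> \<partial>M)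
      = (\<Sum>j. \<integral>\<^sup>+\<omega>. weighted_exceedances k (layer_width * k + j) \<omega> \<partial>M) * ennreal ((1 / (2 * m ^ layer_width)) ^ k)"
    unfolding layer_functional_def by (simp add: nn_integral_multc nn_integral_suminf)
  also have "\<dots> \<le> (\<Sum>j. ennreal (?c * (m ^ j * tail j))) * ennreal ((1 / (2 * m ^ layer_width)) ^ k)"
    using assms layer_width(1)
    by (intro mult_right_mono suminf_le summableI nn_integral_weighted_exceedances) auto
  also have "(\<Sum>j. ennreal (?c * (m ^ j * tail j))) = ennreal (\<Sum>j. ?c * (m ^ j * tail j))"
    using m_gt_1 tail_nonneg by (intro suminf_ennreal2 summable_mult summable_tail) auto
  also have "(\<Sum>j. ?c * (m ^ j * tail j)) = ?c * tail_mass"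
    unfolding tail_mass_def by (rule suminf_mult[OF summable_tail])
  also have "ennreal (?c * tail_mass) * ennreal ((1 / (2 * m ^ layer_width)) ^ k)
      = ennreal (?c * tail_mass * (1 / (2 * m ^ layer_width)) ^ k)"
    using m_gt_1 by (intro ennreal_mult''[symmetric]) simp
  also have "?c * tail_mass * (1 / (2 * m ^ layer_width)) ^ k = exp (2 * m ^ layer_width * tail_mass) * tail_mass * (1/2) ^ k"
    unfolding power_mult using m_gt_1 by (simp add: power_divide power_mult_distrib field_simps)
  finally show ?thesis .
qed

text \<open>A vertex violating the bound forces \<open>layer_functional k\<close> to be at least 1.
  The expectations are summable in \<open>k\<close>, so this happens for finitely many
  \<open>k\<close> only.\<close>

lemma AE_layer:
  "AE \<omega> in M. \<forall>\<^sub>F k in sequentially. \<forall>v\<in>gw_tree (\<lambda>v. N v \<omega>).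
     layer_width * k \<le> length v \<longrightarrow> exceeds k (length v) (\<eta> v \<omega>) \<longrightarrow>
     card {i \<in> {layer_width * k..<length v}. exceeds k i (\<eta> (take i v) \<omega>)} < k"
proof -
  let ?c = "2 * m ^ layer_width"
  \<comment> \<open>The shift by one excludes \<open>k = 0\<close>, where level 0 would be
    included.\<close>
  have "AE \<omega> in M. \<forall>\<^sub>F k in sequentially. layer_functional (Suc k) \<omega> < 1"
  proof (rule AE_eventually_less_one)
    show "layer_functional (Suc k) \<in> borel_measurable M" for k
      unfolding layer_functional_def by measurable
    have "(\<Sum>k. \<integral>\<^sup>+\<omega>. layer_functional (Suc k) \<omega> \<partial>M)
        \<le> (\<Sum>k. ennreal (exp (?c * tail_mass) * tail_mass * (1/2) ^ Suc k))"
      by (intro suminf_le summableI nn_integral_layer_functional) simp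
    also have "\<dots> < \<infinity>"
      using sum_tail_le[of "{}"]
      by (subst suminf_ennreal2) (auto intro!: summable_mult summable_geometric simp del: power_Suc simp: summable_Suc_iff)
    finally show "(\<Sum>k. \<integral>\<^sup>+\<omega>. layer_functional (Suc k) \<omega> \<partial>M) < \<infinity>" .
  qed
  then show ?thesis
  proof eventually_elim
    case (elim \<omega>)
    then have "\<forall>\<^sub>F k in sequentially. layer_functional k \<omega> < 1"
      by (subst (asm) eventually_sequentially_Suc)
    moreover have "\<forall>\<^sub>F k::nat in sequentially. k > 0" by (rule eventually_gt_at_top)
    ultimately show ?case
    proof eventually_elim
      case (elim k)
      show ?case
      proof (intro ballI impI, rule ccontr)
        fix v assume v: "v \<in> gw_tree (\<lambda>v. N v \<omega>)" and n: "layer_width * k \<le> length v" and ex: "exceeds k (length v) (\<eta> v \<omega>)"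
        let ?E = "{i \<in> {layer_width * k..<length v}. exceeds k i (\<eta> (take i v) \<omega>)}" and ?n = "length v"
        assume "\<not> card ?E < k"
        then have card: "k \<le> card ?E" by simp
        have n0: "layer_width * k > 0" using elim layer_width(1) by simp
        then have "?n \<noteq> 0" using n by linarith
        have "1 \<le> ?c" using one_le_power[OF less_imp_le[OF m_gt_1], of layer_width] by linarith
        then have "?c ^ k \<le> ?c ^ card ?E" using card by (intro power_increasing)
        \<comment> \<open>The root, which has no increment, is not in \<open>?E\<close>, because
          \<open>layer_width * k\<close> is positive.\<close>
        also have "?E = {1..<?n} \<inter> ?E"
        proof -
          have "1 \<le> i" if "layer_width * k \<le> i" for i
            using that n0 by linarith
          then show ?thesis by auto
        qed
        also have "?c ^ card ({1..<?n} \<inter> ?E) = (\<Prod>i\<in>{1..<?n}. if i \<in> ?E then ?c else 1)"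
          by (subst prod.inter_restrict[symmetric]) auto
        finally have "ennreal (?c ^ k) \<le> ennreal (\<Prod>i\<in>{1..<?n}. if i \<in> ?E then ?c else 1)"
          by (rule ennreal_leI)
        also have "\<dots> = (\<Prod>i\<in>{1..<?n}. ennreal (if i \<in> ?E then ?c else 1))"
          using m_gt_1 by (intro prod_ennreal[symmetric]) auto
        also have "\<dots> = (\<Prod>i\<in>{1..<?n}. weight k ?n i (\<eta> (take i v) \<omega>))"
          by (intro prod.cong) (auto simp: weight_def)
        also have "\<dots> = (\<Prod>i\<in>insert ?n {1..<?n}. weight k ?n i (\<eta> (take i v) \<omega>))"
          using ex by (subst prod.insert) (auto simp: weight_def)
        also have "insert ?n {1..<?n} = {1..?n}" using \<open>?n \<noteq> 0\<close> by (intro Icc_1_eq_insert[symmetric]) simp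
        also have "(\<Prod>i\<in>{1..?n}. weight k ?n i (\<eta> (take i v) \<omega>))
            = indicator (gw_tree (\<lambda>v. N v \<omega>)) v * (\<Prod>i\<in>{1..?n}. weight k ?n i (\<eta> (take i v) \<omega>))"
          using v by simp
        also have "\<dots> \<le> weighted_exceedances k ?n \<omega>"
          unfolding weighted_exceedances_def by (rule nn_integral_ge_point) simp
        also have "\<dots> = (\<Sum>j\<in>{?n - layer_width * k}. weighted_exceedances k (layer_width * k + j) \<omega>)"
          using n by simp
        also have "\<dots> \<le> (\<Sum>j. weighted_exceedances k (layer_width * k + j) \<omega>)"
          by (intro sum_le_suminf) auto
        finally have "ennreal (?c ^ k) * ennreal ((1 / ?c) ^ k) \<le> layer_functional k \<omega>"
          unfolding layer_functional_def by (intro mult_right_mono) auto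
        moreover have "ennreal (?c ^ k) * ennreal ((1 / ?c) ^ k) = 1"
          using m_gt_1 by (subst ennreal_mult''[symmetric]) (simp_all only: power_one_over, simp_all)
        ultimately show False using elim by simp
      qed
    qed
  qed
qed

text \<open>For \<open>k = 0\<close> the threshold is 1, and the expected weighted counts are
  summable over the levels. Hence from some level on no vertex exceeds 1, and the levels before it
  are finite.\<close>

lemma AE_bounded_increments:
  "AE \<omega> in M. \<exists>A. \<forall>v\<in>gw_tree (\<lambda>v. N v \<omega>). m powr (- (real (length v) * H)) * \<bar>\<eta> v \<omega>\<bar> \<le> A"
proof -
  let ?c = "2 * m ^ layer_width"
  have "AE \<omega> in M. \<forall>\<^sub>F j in sequentially. weighted_exceedances 0 (Suc j) \<omega> < 1"
  proof (rule AE_eventually_less_one)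
    have le: "(\<integral>\<^sup>+\<omega>. weighted_exceedances 0 (Suc j) \<omega> \<partial>M) \<le> ennreal (exp (?c * tail_mass) * (m ^ Suc j * tail (Suc j)))" for j
      using nn_integral_weighted_exceedances[of 0 "Suc j"] by simp
    have "(\<Sum>j. \<integral>\<^sup>+\<omega>. weighted_exceedances 0 (Suc j) \<omega> \<partial>M)
        \<le> (\<Sum>j. ennreal (exp (?c * tail_mass) * (m ^ Suc j * tail (Suc j))))"
      by (intro suminf_le summableI le)
    also have "\<dots> = ennreal (\<Sum>j. exp (?c * tail_mass) * (m ^ Suc j * tail (Suc j)))"
      using m_gt_1 by (intro suminf_ennreal2 summable_mult summable_Suc_iff[THEN iffD2, OF summable_tail])
        (auto simp: tail_nonneg)
    finally show "(\<Sum>j. \<integral>\<^sup>+\<omega>. weighted_exceedances 0 (Suc j) \<omega> \<partial>M) < \<infinity>"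
      using le_less_trans by fastforce
  qed measurable
  then show ?thesis
  proof eventually_elim
    case (elim \<omega>)
    then obtain n0 where n0: "\<And>j. j \<ge> n0 \<Longrightarrow> weighted_exceedances 0 (Suc j) \<omega> < 1"
      unfolding eventually_sequentially by blast
    let ?T = "gw_tree (\<lambda>v. N v \<omega>)" and ?x = "\<lambda>v. m powr (- (real (length v) * H)) * \<bar>\<eta> v \<omega>\<bar>"
    \<comment> \<open>This includes the root, whose value of \<open>\<eta>\<close> is
      arbitrary.\<close>
    define F where "F = (\<Union>n\<in>{..n0}. {v \<in> ?T. length v = n})"
    have "finite F" unfolding F_def by (intro finite_UN_I finite_gw_level) auto
    have late: "?x v \<le> 1" if v: "v \<in> ?T" "v \<notin> F" for v
    proof (rule ccontr)
      assume "\<not> ?x v \<le> 1"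
      then have ex: "exceeds 0 (length v) (\<eta> v \<omega>)"
        using m_gt_1 by (simp add: exceeds_def powr_minus field_simps)
      have len: "length v > n0" using v by (auto simp: F_def not_less[symmetric])
      then obtain j where j: "length v = Suc j" "j \<ge> n0" by (cases "length v") auto
      let ?n = "length v"
      have c: "1 \<le> ?c" using one_le_power[OF less_imp_le[OF m_gt_1], of layer_width] by linarith
      have "1 = (\<Prod>i\<in>{1..?n}. 1 :: ennreal)" by simp
      \<comment> \<open>All weights of ancestors are at least 1, so the weighted count dominates the
        plain count.\<close>
      also have "\<dots> \<le> (\<Prod>i\<in>{1..?n}. weight 0 ?n i (\<eta> (take i v) \<omega>))"
        using ex c by (intro prod_mono_ennreal) (auto simp: weight_def ennreal_ge_1)
      also have "\<dots> = indicator ?T v * (\<Prod>i\<in>{1..?n}. weight 0 ?n i (\<eta> (take i v) \<omega>))"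
        using v by simp
      also have "\<dots> \<le> weighted_exceedances 0 ?n \<omega>"
        unfolding weighted_exceedances_def by (rule nn_integral_ge_point) simp
      finally show False using n0[OF j(2)] j(1) by simp
    qed
    have "?x v \<le> Max (insert 1 (?x ` F))" if "v \<in> ?T" for v
      using late[OF that] \<open>finite F\<close> by (cases "v \<in> F") (auto intro!: Max_ge simp: Max_ge_iff)
    then show ?case by blast
  qed
qed

end

text \<open>Among \<open>k + 1\<close> elements the largest would have \<open>k\<close> others below
  it. This turns the bound on exceeding ancestors of a vertex into a bound along a whole
  ray.\<close>

lemma card_le_of_card_below:
  fixes E :: "nat set"
  assumes "\<And>n. n \<in> E \<Longrightarrow> card (E \<inter> {..<n}) < k"
  shows "finite E \<and> card E \<le> k"
proof (rule ccontr)
  assume "\<not> (finite E \<and> card E \<le> k)"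
  then obtain F where F: "F \<subseteq> E" "card F = Suc k" "finite F"
    by (metis infinite_arbitrarily_large obtain_subset_with_card_n not_less_eq_eq)
  then have "F \<noteq> {}" by auto
  define n where "n = Max F"
  have n: "n \<in> F" "\<And>i. i \<in> F \<Longrightarrow> i \<le> n"
    using F \<open>F \<noteq> {}\<close> by (auto simp: n_def)
  have "k = card (F - {n})" using F n by simp
  also have "\<dots> \<le> card (E \<inter> {..<n})"
    using F n by (intro card_mono) (force simp: less_le)+
  finally show False using assms[of n] n F by auto
qed

lemma ray_vertex_simps [simp]:
  "length (ray_vertex t n) = n" "i \<le> n \<Longrightarrow> take i (ray_vertex t n) = ray_vertex t i"
  by (auto simp: ray_vertex_def take_map)

text \<open>The layer counts and the bound \<open>A\<close> hold for all vertices at once, so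
  \<open>layered_sum_bound\<close> gives one bound \<open>B\<close> for the absolute series along
  every ray.\<close>

lemma (in finite_moment_dbrw) AE_bounded:
  "AE \<omega> in M. (\<forall>t\<in>rays (\<lambda>v. N v \<omega>). summable (dbrw_term m H (\<lambda>v. \<eta> v \<omega>) t))
     \<and> dbrw_sup m H (\<lambda>v. N v \<omega>) (\<lambda>v. \<eta> v \<omega>) < \<infinity>"
  using AE_layer AE_bounded_increments
proof eventually_elim
  case (elim \<omega>)
  let ?T = "gw_tree (\<lambda>v. N v \<omega>)" and ?d = "dbrw_term m H (\<lambda>v. \<eta> v \<omega>)"
  from elim(1) obtain k0 where k0: "\<And>k v. k \<ge> k0 \<Longrightarrow> v \<in> ?T \<Longrightarrow> layer_width * k \<le> length v \<Longrightarrow>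
      exceeds k (length v) (\<eta> v \<omega>) \<Longrightarrow> card {i \<in> {layer_width * k..<length v}. exceeds k i (\<eta> (take i v) \<omega>)} < k"
    unfolding eventually_sequentially by blast
  from elim(2) obtain A where A: "\<And>v. v \<in> ?T \<Longrightarrow> m powr (- (real (length v) * H)) * \<bar>\<eta> v \<omega>\<bar> \<le> A"
    by blast
  define c where "c = layer_width + 1"
  define B where "B = A * real (c * k0) + (\<Sum>k. (1/2) ^ (k0 + k) * real (c * Suc (k0 + k)))"
  have bound: "(\<Sum>i<L. \<bar>?d t i\<bar>) \<le> B" if t: "t \<in> rays (\<lambda>v. N v \<omega>)" for t L
  proof -
    have T: "ray_vertex t n \<in> ?T" for n using t by (auto simp: rays_def)
    \<comment> \<open>The value 0 at \<open>n = 0\<close> aligns the index with the level: the term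
      \<open>?d t i\<close> belongs to level \<open>Suc i\<close>.\<close>
    define x where "x n = (if n = 0 then 0 else m powr (- (real n * H)) * \<bar>\<eta> (ray_vertex t n) \<omega>\<bar>)" for n
    have A0: "0 \<le> A" using A[OF T[of 0]] by (rule order_trans[rotated]) simp
    have "(\<Sum>n<Suc L. x n) \<le> B"
      unfolding B_def
    proof (rule layered_sum_bound)
      show "0 \<le> x n" for n by (simp add: x_def)
      show "x n \<le> A" for n using A[OF T[of n]] A0 by (simp add: x_def)
      fix k assume k: "k \<ge> k0"
      define E where "E = {n. layer_width * k \<le> n \<and> exceeds k n (\<eta> (ray_vertex t n) \<omega>)}"
      have E: "finite E \<and> card E \<le> k"
      proof (rule card_le_of_card_below)
        fix n assume n: "n \<in> E"
        have "E \<inter> {..<n} = {i \<in> {layer_width * k..<n}. exceeds k i (\<eta> (take i (ray_vertex t n)) \<omega>)}"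
          by (auto simp: E_def)
        then show "card (E \<inter> {..<n}) < k"
          using k0[OF k T[of n]] n by (auto simp: E_def)
      qed
      have sub: "{n. (1/2) ^ k < x n} \<subseteq> {..<layer_width * k} \<union> E"
      proof
        fix n assume "n \<in> {n. (1/2) ^ k < x n}"
        then have "(1/2) ^ k < x n" by simp
        moreover have "(0::real) < (1/2) ^ k" by simp
        ultimately have "n \<noteq> 0" "(1/2) ^ k < m powr (- (real n * H)) * \<bar>\<eta> (ray_vertex t n) \<omega>\<bar>"
          by (auto simp: x_def split: if_splits)
        then have "exceeds k n (\<eta> (ray_vertex t n) \<omega>)"
          using m_gt_1 by (simp add: exceeds_def powr_minus field_simps)
        then show "n \<in> {..<layer_width * k} \<union> E" by (auto simp: E_def)
      qed
      \<comment> \<open>All \<open>layer_width * k\<close> early levels are counted as if they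
        exceeded; later ones contribute at most \<open>k\<close>.\<close>
      have "card ({..<layer_width * k} \<union> E) \<le> c * k"
        using card_Un_le[of "{..<layer_width * k}" E] E by (simp add: c_def)
      with sub E show "finite {n. (1/2) ^ k < x n} \<and> card {n. (1/2) ^ k < x n} \<le> c * k"
        by (meson card_mono finite_Un finite_lessThan finite_subset le_trans)
    qed
    moreover have "(\<Sum>n<Suc L. x n) = (\<Sum>i<L. \<bar>?d t i\<bar>)"
      by (subst sum.lessThan_Suc_shift) (simp add: x_def dbrw_term_def abs_mult)
    ultimately show ?thesis by simp
  qed
  have abs: "summable (\<lambda>i. \<bar>?d t i\<bar>)" if "t \<in> rays (\<lambda>v. N v \<omega>)" for t
    by (rule summableI_nonneg_bounded[OF _ bound[OF that]]) simp
  have "\<bar>dbrw m H (\<lambda>v. \<eta> v \<omega>) t\<bar> \<le> B" if "t \<in> rays (\<lambda>v. N v \<omega>)" for t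
    unfolding dbrw_def
    by (rule order_trans[OF summable_rabs[OF abs[OF that]] suminf_le_const[OF abs[OF that] bound[OF that]]])
  then have "dbrw_sup m H (\<lambda>v. N v \<omega>) (\<lambda>v. \<eta> v \<omega>) \<le> ennreal B"
    unfolding dbrw_sup_def by (intro SUP_least ennreal_leI) auto
  then show ?case
    using summable_rabs_cancel[OF abs] le_less_trans[of _ "ennreal B" \<infinity>] by auto
qed

subsection \<open>The generating function recursion\<close>

text \<open>About \<open>ln k / ln l\<close> terms are bounded by 1. After them
  \<open>k * (1 / l) ^ i\<close> has dropped below 1 and the rest is a geometric series.\<close>

lemma sum_min_geometric_le:
  fixes l :: real
  assumes "l > 1" "k \<ge> 1"
  shows "(\<Sum>i<n. min 1 (real k * (1 / l) ^ i)) \<le> ln (real k) / ln l + 1 + l / (l - 1)"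
proof -
  define I where "I = nat \<lceil>ln (real k) / ln l\<rceil>"
  have ln0: "0 \<le> ln (real k) / ln l" using assms by simp
  then have I: "real I \<le> ln (real k) / ln l + 1" "ln (real k) / ln l \<le> real I"
    unfolding I_def by linarith+
  have "ln (real k) \<le> real I * ln l" using I(2) assms by (simp add: field_simps)
  then have "ln (real k) \<le> ln (l ^ I)" using assms by (simp add: ln_realpow)
  then have kI: "real k * (1 / l) ^ I \<le> 1" using assms by (simp add: power_one_over field_simps)
  have split: "(\<Sum>i<I + n. g i) = (\<Sum>i<I. g i) + (\<Sum>j<n. g (I + j))" for g :: "nat \<Rightarrow> real"
    by (induction n) auto
  have "(\<Sum>i<n. min 1 (real k * (1 / l) ^ i)) \<le> (\<Sum>i<I + n. min 1 (real k * (1 / l) ^ i))"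
    using assms by (intro sum_mono2) auto
  also have "\<dots> \<le> (\<Sum>i<I. 1) + (\<Sum>j<n. (1 / l) ^ j)"
    unfolding split
  proof (intro add_mono sum_mono)
    fix j
    have "real k * (1 / l) ^ I * (1 / l) ^ j \<le> 1 * (1 / l) ^ j"
      using kI assms by (intro mult_right_mono) auto
    then show "min 1 (real k * (1 / l) ^ (I + j)) \<le> (1 / l) ^ j"
      by (simp add: power_add mult.assoc min.coboundedI2)
  qed simp
  also have "(\<Sum>j<n. (1 / l) ^ j) \<le> (\<Sum>j. (1 / l) ^ j)"
    using assms by (intro sum_le_suminf summable_geometric) auto
  also have "(\<Sum>j. (1 / l) ^ j) = l / (l - 1)"
    using assms by (subst suminf_geometric) (auto simp: field_simps)
  finally show ?thesis using I(1) by simp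
qed

text \<open>With \<open>x = k * z < 1\<close>, Bernoulli gives
  \<open>(1 - z) ^ k * (1 + x) \<le> (1 - z\<^sup>2) ^ k \<le> 1\<close>, and
  \<open>1 / (1 + x) \<le> 1 - x + x\<^sup>2\<close>. For larger \<open>x\<close> the left side
  vanishes.\<close>

lemma one_minus_power_ge:
  fixes z :: real
  assumes "0 \<le> z" "z \<le> 1"
  shows "real k * z * (1 - min 1 (real k * z)) \<le> 1 - (1 - z) ^ k"
proof (cases "real k * z < 1")
  case False
  then show ?thesis using assms by (simp add: power_le_one)
next
  case True
  define x where "x = real k * z"
  have x: "0 \<le> x" using assms by (simp add: x_def)
  have "(1 - z) ^ k * (1 + x) \<le> (1 - z) ^ k * (1 + z) ^ k"
    unfolding x_def using assms Bernoulli_inequality[of z k] by (intro mult_left_mono) auto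
  also have "\<dots> = (1 - z * z) ^ k"
    by (simp add: power_mult_distrib[symmetric] algebra_simps)
  also have "\<dots> \<le> 1"
    using assms by (intro power_le_one) (auto simp: mult_le_one)
  also have "1 \<le> (1 - x + x * x) * (1 + x)"
    using x by (simp add: algebra_simps)
  finally have "(1 - z) ^ k \<le> 1 - x + x * x"
    using x by (simp add: mult_le_cancel_right)
  moreover have "min 1 x = x" using True by (simp add: x_def)
  ultimately show ?thesis unfolding x_def[symmetric] by (simp add: algebra_simps)
qed

section \<open>The generating function near 1\<close>

locale kesten_stigum_offspring =
  fixes Z :: "nat pmf" and m :: real
  assumes Z_integrable: "integrable (measure_pmf Z) real"
    and m_eq: "m = measure_pmf.expectation Z real"
    and m_gt_1: "m > 1"
    and no_leaves: "measure_pmf.prob Z {0} = 0"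
    and Z_log_Z: "(\<integral>\<^sup>+k. ennreal (real k * ln (real k)) \<partial>measure_pmf Z) < \<infinity>"
begin

definition pgf :: "real \<Rightarrow> real" where
  "pgf s = measure_pmf.expectation Z (\<lambda>k. s ^ k)"

text \<open>Controls the error of the linear approximation \<open>m * z\<close> to
  \<open>1 - pgf (1 - z)\<close>. The quadratic term \<open>k\<^sup>2 * z\<close> is truncated at
  \<open>k\<close>, so that a finite mean of \<open>Z\<close> makes it integrable.\<close>

definition defect :: "real \<Rightarrow> real" where
  "defect z = measure_pmf.expectation Z (\<lambda>k. real k * min 1 (real k * z))"

lemma set_pmf_pos: "k \<in> set_pmf Z \<Longrightarrow> k \<ge> 1"
  using no_leaves by (cases k) (auto simp: measure_pmf_single set_pmf_iff)

lemma integrable_power: "0 \<le> s \<Longrightarrow> s \<le> 1 \<Longrightarrow> integrable (measure_pmf Z) (\<lambda>k. s ^ k)" for s :: real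
  by (rule measure_pmf.integrable_const_bound[where B = 1]) (auto simp: power_le_one)

lemma pgf_mono: "0 \<le> s \<Longrightarrow> s \<le> t \<Longrightarrow> t \<le> 1 \<Longrightarrow> pgf s \<le> pgf t"
  unfolding pgf_def by (intro integral_mono integrable_power power_mono) auto

lemma pgf_le: "0 \<le> s \<Longrightarrow> s \<le> 1 \<Longrightarrow> pgf s \<le> s"
proof -
  assume s: "0 \<le> s" "s \<le> 1"
  have "pgf s \<le> measure_pmf.expectation Z (\<lambda>_. s)"
    unfolding pgf_def
  proof (intro integral_mono_AE integrable_power s)
    show "AE k in measure_pmf Z. s ^ k \<le> s"
      unfolding AE_measure_pmf_iff using power_decreasing[of 1 _ s] s set_pmf_pos by auto
  qed simp
  then show ?thesis by simp
qed

text \<open>Equality in \<open>s ^ k \<le> s\<close> almost surely would mean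
  \<open>Z \<le> 1\<close>, against \<open>m > 1\<close>.\<close>

lemma pgf_less: "0 < s \<Longrightarrow> s < 1 \<Longrightarrow> pgf s < s"
proof -
  assume s: "0 < s" "s < 1"
  have "pgf s \<noteq> s"
  proof
    assume "pgf s = s"
    have int: "integrable (measure_pmf Z) (\<lambda>k. s - s ^ k)"
      using s by (intro Bochner_Integration.integrable_diff integrable_power) auto
    have nn: "AE k in measure_pmf Z. 0 \<le> s - s ^ k"
      unfolding AE_measure_pmf_iff using power_decreasing[of 1 _ s] s set_pmf_pos by auto
    have "measure_pmf.expectation Z (\<lambda>k. s - s ^ k) = 0"
      using \<open>pgf s = s\<close> s unfolding pgf_def
      by (subst Bochner_Integration.integral_diff) (auto intro!: integrable_power)
    then have "AE k in measure_pmf Z. s - s ^ k = 0"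
      using integral_nonneg_eq_0_iff_AE[OF int nn] by blast
    moreover have "k \<le> 1" if "s - s ^ k = 0" for k
    proof (rule ccontr)
      assume "\<not> k \<le> 1"
      then have "s ^ k < s ^ 1" using s by (intro power_strict_decreasing) auto
      with that show False by simp
    qed
    ultimately have "AE k in measure_pmf Z. real k \<le> 1"
      by (auto elim!: AE_mp)
    then have "m \<le> measure_pmf.expectation Z (\<lambda>_. 1)"
      unfolding m_eq by (intro integral_mono_AE Z_integrable) auto
    with m_gt_1 show False by simp
  qed
  with pgf_le[of s] s show ?thesis by simp
qed

lemma integrable_defect: "0 \<le> z \<Longrightarrow> integrable (measure_pmf Z) (\<lambda>k. real k * min 1 (real k * z))"
  by (rule Bochner_Integration.integrable_bound[OF Z_integrable]) (auto simp: mult_le_cancel_left2)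

lemma defect_mono: "0 \<le> z \<Longrightarrow> z \<le> w \<Longrightarrow> defect z \<le> defect w"
  unfolding defect_def
  by (intro integral_mono integrable_defect mult_left_mono min.mono) (auto intro: mult_left_mono)

lemma defect_nonneg: "0 \<le> z \<Longrightarrow> 0 \<le> defect z"
  unfolding defect_def by (intro integral_nonneg_AE) auto

lemma defect_le: "0 \<le> z \<Longrightarrow> defect z \<le> m"
  unfolding defect_def m_eq
  by (intro integral_mono integrable_defect Z_integrable) (auto simp: mult_le_cancel_left2)

lemma one_minus_pgf_ge:
  assumes "0 \<le> z" "z \<le> 1"
  shows "z * (m - defect z) \<le> 1 - pgf (1 - z)"
proof -
  have "z * (m - defect z) = measure_pmf.expectation Z (\<lambda>k. z * (real k - real k * min 1 (real k * z)))"
    unfolding m_eq defect_def using assms integrable_defect Z_integrable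
    by (simp add: Bochner_Integration.integral_diff)
  also have "\<dots> \<le> measure_pmf.expectation Z (\<lambda>k. 1 - (1 - z) ^ k)"
  proof (intro integral_mono)
    show "z * (real k - real k * min 1 (real k * z)) \<le> 1 - (1 - z) ^ k" for k
      using one_minus_power_ge[OF assms, of k] by (simp add: algebra_simps)
  qed (use assms in \<open>auto intro!: integrable_defect Z_integrable integrable_power\<close>)
  also have "\<dots> = 1 - pgf (1 - z)"
    unfolding pgf_def using assms by (subst Bochner_Integration.integral_diff) (auto intro!: integrable_power)
  finally show ?thesis .
qed

text \<open>This is where the \<open>Z log Z\<close> condition enters.\<close>

lemma summable_defect:
  assumes "l > 1"
  shows "summable (\<lambda>i. defect ((1 / l) ^ i))"
proof (rule summableI_nonneg_bounded)
  \<comment> \<open>For a fixed value \<open>k\<close> of \<open>Z\<close>, \<open>?g k\<close>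
    bounds the sum over all \<open>i\<close>; its integrability is the \<open>Z log Z\<close>
    condition together with the finite mean.\<close>
  let ?g = "\<lambda>k. real k * ln (real k) / ln l + (1 + l / (l - 1)) * real k"
  have nn: "0 \<le> real k * ln (real k)" for k
    by (cases "k = 0") auto
  have int: "integrable (measure_pmf Z) (\<lambda>k. real k * ln (real k))"
    using Z_log_Z nn by (intro integrableI_nonneg) auto
  show "0 \<le> defect ((1 / l) ^ i)" for i
    using assms by (intro defect_nonneg) auto
  fix n
  have "(\<Sum>i<n. defect ((1 / l) ^ i)) = measure_pmf.expectation Z (\<lambda>k. \<Sum>i<n. real k * min 1 (real k * (1 / l) ^ i))"
    unfolding defect_def using assms by (subst Bochner_Integration.integral_sum) (auto intro!: integrable_defect)
  also have "\<dots> \<le> measure_pmf.expectation Z ?g"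
  proof (intro integral_mono)
    fix k
    show "(\<Sum>i<n. real k * min 1 (real k * (1 / l) ^ i)) \<le> ?g k"
    proof (cases "k \<ge> 1")
      case True
      have "(\<Sum>i<n. real k * min 1 (real k * (1 / l) ^ i)) = real k * (\<Sum>i<n. min 1 (real k * (1 / l) ^ i))"
        by (simp add: sum_distrib_left)
      also have "\<dots> \<le> real k * (ln (real k) / ln l + 1 + l / (l - 1))"
        by (intro mult_left_mono sum_min_geometric_le assms True) simp
      also have "\<dots> = ?g k" by (simp add: algebra_simps)
      finally show ?thesis .
    qed (simp add: not_le)
  qed (use assms int in \<open>auto intro!: integrable_defect Z_integrable\<close>)
  finally show "(\<Sum>i<n. defect ((1 / l) ^ i)) \<le> measure_pmf.expectation Z ?g" .
qed

text \<open>The sequence increases, and its limit satisfies \<open>L \<le> pgf L\<close>. Strictly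
  between 0 and 1 this is impossible, and \<open>u 0 \<noteq> 0\<close> excludes the limit
  0.\<close>

lemma recursion_tends_to_one:
  assumes u: "\<And>j. 0 \<le> u j" "\<And>j. u j \<le> 1"
    and rec: "\<And>j. u j \<le> pgf (u (Suc j))" and "u 0 \<noteq> 0"
  shows "u \<longlonglongrightarrow> 1"
proof -
  have inc: "incseq u"
    using order_trans[OF rec pgf_le[OF u]] by (rule incseq_SucI)
  then obtain L where L: "u \<longlonglongrightarrow> L" "\<And>j. u j \<le> L"
    using incseq_convergent[OF inc, of 1] u(2) by blast
  have "0 < L" using L(2)[of 0] u(1)[of 0] assms(4) by simp
  have "L \<le> 1" using L(1) u(2) by (intro LIMSEQ_le_const2[OF L(1)]) auto
  have "u j \<le> pgf L" for j
    using rec[of j] pgf_mono[OF u(1)[of "Suc j"] L(2)[of "Suc j"] \<open>L \<le> 1\<close>] by simp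
  then have "L \<le> pgf L"
    by (intro LIMSEQ_le_const2[OF L(1)]) auto
  then have "L = 1"
    using pgf_less[of L] \<open>0 < L\<close> \<open>L \<le> 1\<close> by (cases "L = 1") auto
  with L show ?thesis by simp
qed

text \<open>
  If \<open>u\<close> does not vanish, then \<open>y = 1 - u\<close> decays geometrically, the accumulated defects are summable,
  and unrolling the recursion bounds \<open>m ^ j * y j\<close> below by a multiple of the tail of \<open>\<Sum>i. m ^ i * p i\<close>.
\<close>

lemma recursion_vanishes:
  assumes u: "\<And>j. 0 \<le> u j" "\<And>j. u j \<le> 1" and p: "\<And>j. 0 \<le> p j" "\<And>j. p j \<le> 1"
    and rec: "\<And>j. u j \<le> pgf ((1 - p (Suc j)) * u (Suc j))"
    and not_summable: "\<not> summable (\<lambda>j. m ^ j * p j)"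
  shows "u 0 = 0"
proof (rule ccontr)
  assume u0: "u 0 \<noteq> 0"
  define y where "y j = 1 - u j" for j
  \<comment> \<open>\<open>1 - z j\<close> is the argument at which the recursion evaluates
    \<open>pgf\<close>.\<close>
  define z where "z j = 1 - (1 - p j) * u j" for j
  have pu: "0 \<le> (1 - p j) * u j" "(1 - p j) * u j \<le> u j" for j
    using u[of j] p[of j] by (auto simp: mult_left_le_one_le)
  have y: "0 \<le> y j" "y j \<le> 1" and z: "0 \<le> z j" "z j \<le> 1" and yz: "y j \<le> z j" for j
    using u[of j] pu[of j] by (auto simp: y_def z_def)
  have rec_y: "z (Suc j) * (m - defect (z (Suc j))) \<le> y j" for j
    using one_minus_pgf_ge[OF z, of "Suc j"] rec[of j] by (simp add: y_def z_def)
  have zy: "z (Suc j) \<le> y j" for j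
    using rec[of j] pgf_le[OF pu(1) order_trans[OF pu(2) u(2)], of "Suc j"] by (simp add: y_def z_def)
  have "u \<longlonglongrightarrow> 1"
    using pgf_mono[OF pu(1) pu(2) u(2)] by (intro recursion_tends_to_one u u0) (blast intro: order_trans rec)
  then have "(\<lambda>j. 1 - u j) \<longlonglongrightarrow> 1 - 1" by (intro tendsto_diff tendsto_const)
  then have y_lim: "y \<longlonglongrightarrow> 0" by (simp add: y_def[abs_def])

  \<comment> \<open>A preliminary decay rate; any value strictly between 1 and \<open>m\<close>
    would serve.\<close>
  define l where "l = (1 + m) / 2"
  have l: "1 < l" "l < m" using m_gt_1 by (auto simp: l_def field_simps)
  let ?r = "\<lambda>i. defect ((1 / l) ^ i)"
  have sr: "summable ?r" by (rule summable_defect[OF l(1)])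
  have "\<forall>\<^sub>F i in sequentially. ?r i < m - l"
    using summable_LIMSEQ_zero[OF sr] l by (intro order_tendstoD) auto
  \<comment> \<open>For arguments up to \<open>(1 / l) ^ i0\<close> the defect is below
    \<open>m - l\<close>, and there the recursion contracts by the factor
    \<open>1 / l\<close>.\<close>
  then obtain i0 where i0: "?r i0 < m - l" by (auto simp: eventually_sequentially)
  have "\<forall>\<^sub>F j in sequentially. y j < min (1/2) ((1 / l) ^ i0)"
    using y_lim l by (intro order_tendstoD) auto
  \<comment> \<open>The bound \<open>1/2\<close> is used later to keep \<open>u\<close> above
    \<open>1/2\<close>.\<close>
  then obtain J where J: "\<And>j. j \<ge> J \<Longrightarrow> y j < min (1/2) ((1 / l) ^ i0)"
    by (auto simp: eventually_sequentially)
  have step: "l * z (Suc j) \<le> y j" if "j \<ge> J" for j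
  proof -
    have "defect (z (Suc j)) \<le> ?r i0"
      using zy[of j] J[OF that] z[of "Suc j"] by (intro defect_mono) auto
    then have "l * z (Suc j) \<le> (m - defect (z (Suc j))) * z (Suc j)"
      using i0 z by (intro mult_right_mono) auto
    with rec_y[of j] show ?thesis by (simp add: mult.commute)
  qed
  have decay: "z (J + i) \<le> (1 / l) ^ i" for i
  proof (induction i)
    case (Suc i)
    have "l * z (J + Suc i) \<le> (1 / l) ^ i"
      using step[of "J + i"] yz[of "J + i"] Suc by simp
    then show ?case using l by (simp add: field_simps)
  qed (simp add: z)

  obtain k where k: "\<And>n. n \<ge> k \<Longrightarrow> norm (\<Sum>i. ?r (i + n)) < m / 2"
    using suminf_exist_split[OF _ sr, of "m / 2"] m_gt_1 by auto
  \<comment> \<open>From here on the relative defects \<open>d\<close> sum to at most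
    \<open>1/2\<close>.\<close>
  define K where "K = J + k"
  define d where "d i = defect (z (Suc (K + i))) / m" for i
  have d: "0 \<le> d i" "d i \<le> 1" for i
    using defect_nonneg[OF z(1)] defect_le[OF z(1)] m_gt_1 by (auto simp: d_def)
  have sum_d: "(\<Sum>i<n. d i) \<le> 1/2" for n
  proof -
    have sr': "summable (\<lambda>i. ?r (i + Suc k))" using sr by (rule summable_ignore_initial_segment)
    have r0: "0 \<le> ?r i" for i using l by (intro defect_nonneg) auto
    have "(\<Sum>i<n. d i) * m = (\<Sum>i<n. defect (z (J + (i + Suc k))))"
      using m_gt_1 unfolding d_def K_def by (simp add: sum_distrib_right add_ac)
    also have "\<dots> \<le> (\<Sum>i<n. ?r (i + Suc k))"
      by (intro sum_mono defect_mono z decay)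
    also have "\<dots> \<le> (\<Sum>i. ?r (i + Suc k))"
      by (rule sum_le_suminf[OF sr' finite_lessThan r0])
    also have "\<dots> \<le> norm (\<Sum>i. ?r (i + Suc k))" by (simp only: real_norm_def abs_ge_self)
    also have "\<dots> \<le> m / 2" by (intro less_imp_le k) simp
    finally show ?thesis using m_gt_1 by (simp add: field_simps)
  qed
  \<comment> \<open>The accumulated loss against pure growth by \<open>m\<close>; Weierstrass'
    inequality keeps it at least \<open>1/2\<close>.\<close>
  define P where "P n = (\<Prod>i<n. 1 - d i)" for n
  have P: "1/2 \<le> P n" for n
    using Weierstrass_prod_ineq[of "{..<n}" d] d sum_d[of n] by (auto simp: P_def)
  \<comment> \<open>With the growth and the loss compensated, each step lowers \<open>b\<close> by
    at least a quarter of a term of the series. As \<open>b\<close> stays nonnegative, the series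
    converges.\<close>
  define b where "b n = P n * (m ^ n * y (K + n))" for n
  have b_step: "b (Suc n) + m ^ Suc n * p (Suc (K + n)) / 4 \<le> b n" for n
  proof -
    let ?j = "Suc (K + n)"
    \<comment> \<open>One factor \<open>1/2\<close> comes from \<open>u\<close> here, the other from
      \<open>P\<close> below.\<close>
    have "p ?j / 2 \<le> p ?j * u ?j"
      using J[of ?j] p(1)[of ?j] mult_left_mono[of "1/2" "u ?j" "p ?j"] by (simp add: K_def y_def)
    then have zj: "y ?j + p ?j / 2 \<le> z ?j"
      by (simp add: z_def y_def algebra_simps)
    have "1/2 * (p ?j / 2) \<le> P (Suc n) * (p ?j / 2)"
      using P p by (intro mult_right_mono) auto
    then have "P (Suc n) * y ?j + p ?j / 4 \<le> P (Suc n) * (y ?j + p ?j / 2)"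
      by (simp add: algebra_simps)
    also have "\<dots> \<le> P (Suc n) * z ?j"
      using zj P[of "Suc n"] by (intro mult_left_mono) auto
    finally have "m ^ Suc n * (P (Suc n) * y ?j + p ?j / 4) \<le> m ^ Suc n * (P (Suc n) * z ?j)"
      using m_gt_1 by (intro mult_left_mono) auto
    also have "\<dots> = P n * (m ^ n * (z ?j * (m - defect (z ?j))))"
      using m_gt_1 by (simp add: P_def d_def field_simps)
    also have "\<dots> \<le> b n"
      unfolding b_def using P[of n] m_gt_1 rec_y[of "K + n"] by (intro mult_left_mono) auto
    finally show ?thesis by (simp add: b_def algebra_simps)
  qed
  have "(\<Sum>i<n. m ^ Suc i * p (Suc (K + i)) / 4) + b n \<le> b 0" for n
  proof (induction n)
    case (Suc n)
    then show ?case using b_step[of n] by simp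
  qed simp
  moreover have "0 \<le> b n" for n
    using P[of n] y m_gt_1 by (simp add: b_def)
  ultimately have "(\<Sum>i<n. m ^ Suc i * p (Suc (K + i)) / 4) \<le> b 0" for n
    by (meson add_increasing2 order_trans order_refl)
  then have "summable (\<lambda>i. m ^ Suc i * p (Suc (K + i)) / 4)"
    using m_gt_1 p by (intro summableI_nonneg_bounded[where x = "b 0"]) auto
  then have "summable (\<lambda>i. 4 * m ^ K * (m ^ Suc i * p (Suc (K + i)) / 4))"
    by (rule summable_mult)
  also have "(\<lambda>i. 4 * m ^ K * (m ^ Suc i * p (Suc (K + i)) / 4)) = (\<lambda>i. m ^ (i + Suc K) * p (i + Suc K))"
    by (simp add: power_add mult_ac add_ac)
  finally have "summable (\<lambda>j. m ^ j * p j)"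
    by (subst (asm) summable_iff_shift)
  with not_summable show False ..
qed

end

subsection \<open>Infinite moment: large increments and the first large partial sum\<close>

text \<open>Since each \<open>x i powr a\<close> is at most \<open>b\<close>, the remaining power
  \<open>1 - a\<close> of \<open>x i\<close> is at most \<open>b powr (1 / a - 1)\<close>. This
  allows increments with only a small moment to be summed along a path.\<close>

lemma summable_of_powr_summable:
  fixes x :: "nat \<Rightarrow> real"
  assumes x: "\<And>i. 0 \<le> x i" and a: "0 < a" "a \<le> 1" and b: "0 < b"
    and sum: "(\<Sum>i. ennreal (x i powr a)) \<le> ennreal b"
  shows "summable x" "suminf x \<le> b powr (1 / a)"
proof -
  have s: "summable (\<lambda>i. x i powr a)"
    using sum by (intro summable_suminf_not_top) (auto simp: top_unique)
  then have sb: "(\<Sum>i. x i powr a) \<le> b"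
    using sum b by (simp add: suminf_ennreal2)
  have le: "x i \<le> b powr (1 / a - 1) * x i powr a" for i
  proof (cases "x i = 0")
    case False
    have "x i powr a \<le> b"
      using sum_le_suminf[OF s, of "{i}"] sb by simp
    then have "(x i powr a) powr (1 / a - 1) \<le> b powr (1 / a - 1)"
      using a by (intro powr_mono2) auto
    moreover have "(x i powr a) powr (1 / a - 1) * x i powr a = x i"
      using False x[of i] a by (simp add: powr_powr powr_add[symmetric] algebra_simps)
    ultimately show ?thesis
      by (metis mult_right_mono powr_ge_zero)
  qed simp
  show "summable x"
    by (rule summable_comparison_test'[OF summable_mult[OF s, of "b powr (1 / a - 1)"], of 0]) (use le x in simp)
  then have "suminf x \<le> (\<Sum>i. b powr (1 / a - 1) * x i powr a)"
    by (intro suminf_le le summable_mult s)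
  also have "\<dots> = b powr (1 / a - 1) * (\<Sum>i. x i powr a)"
    by (rule suminf_mult[OF s])
  also have "\<dots> \<le> b powr (1 / a - 1) * b"
    by (intro mult_left_mono sb) auto
  also have "\<dots> = b powr (1 / a)"
    using b by (simp add: powr_diff)
  finally show "suminf x \<le> b powr (1 / a)" .
qed

lemma gw_tree_Cons: "i # w \<in> gw_tree T \<longleftrightarrow> i < T [] \<and> w \<in> gw_tree (\<lambda>u. T (i # u))"
  by (auto simp: gw_tree_def less_Suc_eq_0_disj)

lemma take_gw_tree: "v \<in> gw_tree T \<Longrightarrow> take n v \<in> gw_tree T"
  by (auto simp: gw_tree_def min_def)

section \<open>Branching recursion for the absence of large increments\<close>

locale infinite_moment_dbrw = dbrw_environment M Z Y N \<eta> + kesten_stigum_offspring Z m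
  for M :: "'w measure" and Z Y N \<eta> and m :: real +
  fixes H :: real
  assumes H_pos: "H > 0"
    and Y_distribution: "real_distribution Y"
    and moment: "(\<integral>\<^sup>+y. ennreal (\<bar>y\<bar> powr (1 / H)) \<partial>Y) = \<infinity>"
begin

sublocale Y: real_distribution Y by (rule Y_distribution)

text \<open>The subtree rooted at \<open>v\<close> is considered whether or not \<open>v\<close>
  belongs to the tree, so that labels of one level can be treated alike. The threshold uses the
  level counted from the true root.\<close>

definition no_exceedance :: "real \<Rightarrow> nat list \<Rightarrow> 'w set" where
  "no_exceedance K v = {\<omega>\<in>space M. \<forall>w. w \<noteq> [] \<longrightarrow> w \<in> gw_tree (\<lambda>u. N (v @ u) \<omega>) \<longrightarrow>
     \<bar>\<eta> (v @ w) \<omega>\<bar> \<le> K * m powr (real (length v + length w) * H)}"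

definition small_increment :: "real \<Rightarrow> nat list \<Rightarrow> 'w set" where
  "small_increment K v = {\<omega>\<in>space M. \<bar>\<eta> v \<omega>\<bar> \<le> K * m powr (real (length v) * H)}"

text \<open>The increment of \<open>v\<close> itself is left out, which makes it independent of
  everything in this block.\<close>

definition below :: "nat list \<Rightarrow> (nat list + nat list) set" where
  "below v = range (\<lambda>w. Inl (v @ w)) \<union> (\<lambda>w. Inr (v @ w)) ` {w. w \<noteq> []}"

lemma no_exceedance_sets: "no_exceedance K v \<in> sets (info (below v))"
proof -
  have [measurable]: "N (v @ u) \<in> measurable (info (below v)) (count_space UNIV)" for u
    by (rule measurable_info_N) (auto simp: below_def)
  have "Measurable.pred (info (below v)) (\<lambda>\<omega>. \<forall>w. w \<noteq> [] \<longrightarrow> w \<in> gw_tree (\<lambda>u. N (v @ u) \<omega>) \<longrightarrow>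
     \<bar>\<eta> (v @ w) \<omega>\<bar> \<le> K * m powr (real (length v + length w) * H))"
  proof (rule pred_intros_countable(1))
    fix w
    show "Measurable.pred (info (below v)) (\<lambda>\<omega>. w \<noteq> [] \<longrightarrow> w \<in> gw_tree (\<lambda>u. N (v @ u) \<omega>) \<longrightarrow>
       \<bar>\<eta> (v @ w) \<omega>\<bar> \<le> K * m powr (real (length v + length w) * H))"
    proof (cases "w = []")
      case False
      have [measurable]: "\<eta> (v @ w) \<in> borel_measurable (info (below v))"
        by (rule measurable_info_eta) (use False in \<open>auto simp: below_def\<close>)
      show ?thesis unfolding gw_tree_def mem_Collect_eq by measurable
    qed simp
  qed
  from predE[OF this] show ?thesis
    by (simp only: no_exceedance_def space_info)
qed

lemma small_increment_sets: "small_increment K v \<in> sets (info {Inr v})"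
proof -
  have [measurable]: "\<eta> v \<in> borel_measurable (info {Inr v})"
    by (rule measurable_info_eta) simp
  have "Measurable.pred (info {Inr v}) (\<lambda>\<omega>. \<bar>\<eta> v \<omega>\<bar> \<le> K * m powr (real (length v) * H))"
    by measurable
  from predE[OF this] show ?thesis
    by (simp only: small_increment_def space_info)
qed

lemma sets_info_mono: "K \<subseteq> L \<Longrightarrow> A \<in> sets (info K) \<Longrightarrow> A \<in> sets (info L)"
  unfolding sets_info by (erule rev_subsetD[OF _ sigma_sets_mono']) auto

lemma below_subset: "below v \<subseteq> indices"
  by (auto simp: below_def indices_def)

lemma prob_small_increment:
  assumes "v \<noteq> []"
  shows "prob (small_increment K v) = 1 - measure Y {y. K * m powr (real (length v) * H) < \<bar>y\<bar>}"
proof -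
  let ?A = "{y. \<bar>y\<bar> \<le> K * m powr (real (length v) * H)}"
  have "prob (small_increment K v) = measure (distr M borel (\<eta> v)) ?A"
    by (subst measure_distr[OF \<eta>_measurable]) (use assms in \<open>auto simp: small_increment_def intro!: arg_cong[of _ _ prob]\<close>)
  also have "\<dots> = measure Y (space Y - {y. K * m powr (real (length v) * H) < \<bar>y\<bar>})"
    by (simp add: \<eta>_distr assms Y.space_eq_univ, rule arg_cong[of _ _ "measure Y"]) auto
  also have "\<dots> = 1 - measure Y {y. K * m powr (real (length v) * H) < \<bar>y\<bar>}"
    by (rule Y.prob_compl) (simp add: Y.events_eq_borel)
  finally show ?thesis .
qed

lemma no_exceedance_children:
  "no_exceedance K v \<inter> {\<omega>\<in>space M. N v \<omega> = k} \<subseteq>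
    (\<Inter>i<k. small_increment K (v @ [i]) \<inter> no_exceedance K (v @ [i]))"
proof (rule subsetI, rule INT_I, rule IntI)
  fix \<omega> i assume "\<omega> \<in> no_exceedance K v \<inter> {\<omega>\<in>space M. N v \<omega> = k}" "i \<in> {..<k}"
  then have \<omega>: "\<omega> \<in> no_exceedance K v" "i < N v \<omega>" by auto
  then have *: "w \<noteq> [] \<Longrightarrow> w \<in> gw_tree (\<lambda>u. N (v @ u) \<omega>) \<Longrightarrow>
     \<bar>\<eta> (v @ w) \<omega>\<bar> \<le> K * m powr (real (length v + length w) * H)" for w
    by (auto simp: no_exceedance_def)
  show "\<omega> \<in> small_increment K (v @ [i])"
    using *[of "[i]"] \<omega> by (simp add: small_increment_def no_exceedance_def gw_tree_def)
  show "\<omega> \<in> no_exceedance K (v @ [i])"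
    unfolding no_exceedance_def
  proof (intro CollectI conjI allI impI)
    show "\<omega> \<in> space M" using \<omega> by (simp add: no_exceedance_def)
    fix w assume "w \<in> gw_tree (\<lambda>u. N ((v @ [i]) @ u) \<omega>)"
    then have "i # w \<in> gw_tree (\<lambda>u. N (v @ u) \<omega>)"
      using \<omega> by (simp add: gw_tree_Cons)
    then show "\<bar>\<eta> ((v @ [i]) @ w) \<omega>\<bar> \<le> K * m powr (real (length (v @ [i]) + length w) * H)"
      using *[of "i # w"] by simp
  qed
qed

lemma prob_children:
  "prob ({\<omega>\<in>space M. N v \<omega> = k} \<inter> (\<Inter>i<k. small_increment K (v @ [i]) \<inter> no_exceedance K (v @ [i])))
    = pmf Z k * (\<Prod>i<k. prob (small_increment K (v @ [i])) * prob (no_exceedance K (v @ [i])))"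
proof -
  \<comment> \<open>\<open>None\<close> indexes the offspring number of \<open>v\<close>, and
    \<open>Some i\<close> its \<open>i\<close>-th child: the increment of the child together with
    all coordinates below it. These blocks are disjoint.\<close>
  define L where "L = case_option {Inl v} (\<lambda>i. {Inr (v @ [i])} \<union> below (v @ [i]))"
  define C where "C i = small_increment K (v @ [i]) \<inter> no_exceedance K (v @ [i])" for i
  define A where "A = case_option {\<omega>\<in>space M. N v \<omega> = k} C"
  let ?J = "insert None (Some ` {..<k})"
  have "indep_sets (\<lambda>j. sets (info (L j))) ?J"
    by (rule indep_sets_info)
       (auto simp: disjoint_family_on_def L_def below_def indices_def split: option.splits)
  moreover have "\<forall>j\<in>?J. A j \<in> sets (info (L j))"
  proof (safe)
    have "N v -` {k} \<inter> space (info {Inl v}) \<in> sets (info {Inl v})"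
      by (rule measurable_sets[OF measurable_info_N]) auto
    also have "N v -` {k} \<inter> space (info {Inl v}) = A None"
      by (auto simp: A_def)
    finally show "A None \<in> sets (info (L None))" by (simp add: L_def)
    fix i
    show "A (Some i) \<in> sets (info (L (Some i)))"
      by (auto simp: A_def L_def C_def intro!: sets.Int sets_info_mono[OF _ small_increment_sets] sets_info_mono[OF _ no_exceedance_sets])
  qed
  ultimately have "prob (\<Inter>j\<in>?J. A j) = (\<Prod>j\<in>?J. prob (A j))"
    by (intro indep_setsD[of "\<lambda>j. sets (info (L j))" ?J]) auto
  also have "\<dots> = prob (A None) * (\<Prod>i<k. prob (C i))"
    by (subst prod.insert) (auto simp: prod.reindex A_def)
  also have "(\<Prod>i<k. prob (C i)) = (\<Prod>i<k. prob (small_increment K (v @ [i])) * prob (no_exceedance K (v @ [i])))"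
  proof (rule prod.cong)
    fix i
    have "emeasure M (C i) = emeasure M (small_increment K (v @ [i])) * emeasure M (no_exceedance K (v @ [i]))"
      unfolding C_def
      by (rule emeasure_Int_info[OF _ _ below_subset small_increment_sets no_exceedance_sets])
         (auto simp: below_def indices_def)
    then show "prob (C i) = prob (small_increment K (v @ [i])) * prob (no_exceedance K (v @ [i]))"
      by (simp add: measure_def enn2real_mult)
  qed simp
  also have "prob (A None) = pmf Z k"
  proof -
    have "prob (A None) = measure (distr M (count_space UNIV) (N v)) {k}"
      by (subst measure_distr[OF N_measurable]) (auto simp: A_def intro!: arg_cong[of _ _ prob])
    then show ?thesis by (simp add: N_distr measure_pmf_single)
  qed
  also have "(\<Inter>j\<in>?J. A j) = {\<omega>\<in>space M. N v \<omega> = k} \<inter> (\<Inter>i<k. C i)"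
    by (auto simp: A_def)
  finally show ?thesis unfolding C_def .
qed

text \<open>Given \<open>k\<close> children, all of them must have small increments and no
  exceedance below. Independence bounds this by \<open>s ^ k\<close>, and averaging over
  \<open>k\<close> gives the generating function.\<close>

lemma prob_no_exceedance_le:
  assumes s: "\<And>i. prob (small_increment K (v @ [i])) * prob (no_exceedance K (v @ [i])) \<le> s"
    and s1: "s \<le> 1"
  shows "prob (no_exceedance K v) \<le> pgf s"
proof -
  let ?C = "\<lambda>k. {\<omega>\<in>space M. N v \<omega> = k} \<inter> (\<Inter>i<k. small_increment K (v @ [i]) \<inter> no_exceedance K (v @ [i]))"
  let ?q = "\<lambda>i. prob (small_increment K (v @ [i])) * prob (no_exceedance K (v @ [i]))"
  have s0: "0 \<le> s" using s[of 0] by (rule order_trans[rotated]) simp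
  have events: "no_exceedance K w \<in> events" for w
    by (rule sets_info_events[OF below_subset no_exceedance_sets])
  have events': "small_increment K (v @ [i]) \<in> events" for i
    by (rule sets_info_events[OF _ small_increment_sets]) (auto simp: indices_def)
  have [measurable]: "N v \<in> measurable M (count_space UNIV)" by (rule N_measurable)
  have C: "?C k \<in> events" for k
  proof (cases "k = 0")
    case False
    then show ?thesis
      by (intro sets.Int sets.finite_INT events events') auto
  qed simp
  have "no_exceedance K v \<subseteq> (\<Union>k. ?C k)"
  proof
    fix \<omega> assume \<omega>: "\<omega> \<in> no_exceedance K v"
    then have "\<omega> \<in> space M" by (simp add: no_exceedance_def)
    with \<omega> have "\<omega> \<in> ?C (N v \<omega>)" using no_exceedance_children[of K v "N v \<omega>"] by blast
    then show "\<omega> \<in> (\<Union>k. ?C k)" by blast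
  qed
  then have "emeasure M (no_exceedance K v) \<le> emeasure M (\<Union>k. ?C k)"
    using C by (intro emeasure_mono) auto
  also have "\<dots> \<le> (\<Sum>k. emeasure M (?C k))"
    using C by (intro emeasure_subadditive_countably) auto
  also have "\<dots> \<le> (\<Sum>k. ennreal (pmf Z k) * ennreal (s ^ k))"
  proof (intro suminf_le summableI)
    fix k
    have "(\<Prod>i<k. ?q i) \<le> (\<Prod>i<k. s)" by (intro prod_mono) (auto intro: s)
    then have "pmf Z k * (\<Prod>i<k. ?q i) \<le> pmf Z k * s ^ k"
      by (intro mult_left_mono) auto
    then show "emeasure M (?C k) \<le> ennreal (pmf Z k) * ennreal (s ^ k)"
      unfolding emeasure_eq_measure prob_children using s0
      by (subst ennreal_mult[symmetric]) (auto intro!: ennreal_leI)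
  qed
  also have "\<dots> = (\<integral>\<^sup>+k. ennreal (s ^ k) \<partial>measure_pmf Z)"
    by (simp add: nn_integral_measure_pmf nn_integral_count_space_nat)
  finally have le: "emeasure M (no_exceedance K v) \<le> (\<integral>\<^sup>+k. ennreal (s ^ k) \<partial>measure_pmf Z)" .
  have "(\<integral>\<^sup>+k. ennreal (s ^ k) \<partial>measure_pmf Z) = ennreal (pgf s)"
    unfolding pgf_def using s0 s1 by (intro nn_integral_eq_integral integrable_power) auto
  moreover have "0 \<le> pgf s" unfolding pgf_def using s0 by (intro integral_nonneg_AE) auto
  ultimately show ?thesis using le by (simp add: emeasure_eq_measure)
qed

end

context infinite_moment_dbrw
begin

text \<open>The probabilities of seeing no exceedance satisfy the hypotheses of
  \<open>recursion_vanishes\<close>, whose divergent series is supplied by the infinite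
  moment.\<close>

lemma AE_exceedance:
  assumes "K > 0"
  shows "AE \<omega> in M. \<exists>w\<in>gw_tree (\<lambda>v. N v \<omega>). w \<noteq> [] \<and> K * m powr (real (length w) * H) < \<bar>\<eta> w \<omega>\<bar>"
proof -
  define p where "p j = measure Y {y. K * m powr (real j * H) < \<bar>y\<bar>}" for j
  \<comment> \<open>The supremum over a level makes it unnecessary to compare the laws at its
    different labels.\<close>
  define u where "u j = (SUP v\<in>{v. length v = j}. prob (no_exceedance K v))" for j
  have p: "0 \<le> p j" "p j \<le> 1" for j by (auto simp: p_def)
  have ne: "{v :: nat list. length v = j} \<noteq> {}" for j
    using length_replicate[of j 0] by blast
  have bdd: "bdd_above ((\<lambda>v. prob (no_exceedance K v)) ` {v. length v = j})" for j
    by (intro bdd_aboveI[of _ 1]) auto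
  have u_ge: "prob (no_exceedance K v) \<le> u (length v)" for v
    unfolding u_def by (intro cSUP_upper bdd) simp
  have u1: "u j \<le> 1" for j
    unfolding u_def by (intro cSUP_least ne) simp
  have u0: "0 \<le> u j" for j
    using order_trans[OF measure_nonneg u_ge[of "replicate j 0"]] by simp
  have "u 0 = 0"
  proof (rule recursion_vanishes[of u p])
    show "u j \<le> pgf ((1 - p (Suc j)) * u (Suc j))" for j
      unfolding u_def[of j]
    proof (rule cSUP_least[OF ne])
      fix v :: "nat list" assume "v \<in> {v. length v = j}"
      then have v: "length v = j" by simp
      show "prob (no_exceedance K v) \<le> pgf ((1 - p (Suc j)) * u (Suc j))"
      proof (rule prob_no_exceedance_le)
        fix i
        have "prob (small_increment K (v @ [i])) = 1 - p (Suc j)"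
          by (subst prob_small_increment) (auto simp: p_def v)
        then show "prob (small_increment K (v @ [i])) * prob (no_exceedance K (v @ [i])) \<le> (1 - p (Suc j)) * u (Suc j)"
          using u_ge[of "v @ [i]"] p[of "Suc j"] v by (auto intro!: mult_left_mono)
        show "(1 - p (Suc j)) * u (Suc j) \<le> 1"
          using p u0 u1 by (intro mult_le_one) auto
      qed
    qed
    show "\<not> summable (\<lambda>j. m ^ j * p j)"
      unfolding p_def by (rule not_summable_tails[OF m_gt_1 H_pos assms Y_distribution moment])
  qed (fact u0 u1 p)+
  then have "prob (no_exceedance K []) = 0"
    using u_ge[of "[]"] by (simp add: antisym)
  then have "emeasure M (no_exceedance K []) = 0"
    by (simp add: emeasure_eq_measure)
  then have "AE \<omega> in M. \<omega> \<notin> no_exceedance K []"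
    by (intro AE_not_in null_setsI sets_info_events[OF below_subset no_exceedance_sets])
  then show ?thesis
    using AE_space
    by eventually_elim (auto simp: no_exceedance_def not_le)
qed

section \<open>The first vertex with a large partial sum\<close>

definition partial_sum :: "nat list \<Rightarrow> 'w \<Rightarrow> real" where
  "partial_sum v \<omega> = (\<Sum>i<length v. m powr (- (real (Suc i) * H)) * \<eta> (take (Suc i) v) \<omega>)"

text \<open>Where a discounted increment exceeds \<open>2 * K\<close>, the partial sums at the
  vertex and at its parent differ by more than \<open>2 * K\<close>, so one of them exceeds
  \<open>K\<close> in absolute value.\<close>

lemma AE_large_partial_sum:
  assumes "K > 0"
  shows "AE \<omega> in M. \<exists>v\<in>gw_tree (\<lambda>v. N v \<omega>). K < \<bar>partial_sum v \<omega>\<bar>"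
proof -
  have "0 < 2 * K" using assms by simp
  from AE_exceedance[OF this] show ?thesis
  proof (eventually_elim)
    case (elim \<omega>)
    let ?T = "gw_tree (\<lambda>v. N v \<omega>)"
    from elim assms obtain w where w: "w \<in> ?T" "w \<noteq> []" "2 * K * m powr (real (length w) * H) < \<bar>\<eta> w \<omega>\<bar>"
      by auto
    let ?n = "length w - 1" and ?e = "m powr (- (real (length w) * H))"
    let ?w = "take ?n w"
    have len: "length w = Suc ?n" "length ?w = ?n" using w(2) by (cases w; simp)+
    have "partial_sum w \<omega> = (\<Sum>i<?n. m powr (- (real (Suc i) * H)) * \<eta> (take (Suc i) w) \<omega>) + ?e * \<eta> w \<omega>"
      unfolding partial_sum_def by (subst len(1), subst sum.lessThan_Suc) (use len in simp)
    also have "(\<Sum>i<?n. m powr (- (real (Suc i) * H)) * \<eta> (take (Suc i) w) \<omega>) = partial_sum ?w \<omega>"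
      unfolding partial_sum_def len(2) by (intro sum.cong) auto
    finally have "?e * \<bar>\<eta> w \<omega>\<bar> \<le> \<bar>partial_sum w \<omega>\<bar> + \<bar>partial_sum ?w \<omega>\<bar>"
      by (simp add: abs_mult[of ?e, simplified, symmetric])
    moreover have "2 * K < ?e * \<bar>\<eta> w \<omega>\<bar>"
      using w(3) m_gt_1 by (simp add: powr_minus field_simps)
    ultimately have "K < \<bar>partial_sum w \<omega>\<bar> \<or> K < \<bar>partial_sum ?w \<omega>\<bar>" by linarith
    then show ?case using w(1) take_gw_tree[OF w(1), of ?n] by blast
  qed
qed

definition up_to_level :: "nat \<Rightarrow> (nat list + nat list) set" where
  "up_to_level n = Inl ` {v. length v \<le> n} \<union> Inr ` {v. v \<noteq> [] \<and> length v \<le> n}"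

text \<open>Increments suffice: when every vertex has a child, the leftmost path continues whatever
  the offspring numbers are.\<close>

definition beyond_level :: "nat \<Rightarrow> (nat list + nat list) set" where
  "beyond_level n = Inr ` {v. n < length v}"

definition large_at :: "real \<Rightarrow> nat list \<Rightarrow> 'w set" where
  "large_at K v = {\<omega>\<in>space M. v \<in> gw_tree (\<lambda>v. N v \<omega>) \<and> K < \<bar>partial_sum v \<omega>\<bar>}"

text \<open>\<^const>\<open>to_nat\<close> only serves to break ties within a level.\<close>

definition precedes :: "nat list \<Rightarrow> nat list \<Rightarrow> bool" where
  "precedes w v \<longleftrightarrow> (w, v) \<in> measures [length, to_nat]"

definition first_large_at :: "real \<Rightarrow> nat list \<Rightarrow> 'w set" where
  "first_large_at K v = large_at K v - (\<Union>w\<in>{w. precedes w v}. large_at K w)"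

lemma large_at_sets:
  assumes "length v \<le> n"
  shows "large_at K v \<in> sets (info (up_to_level n))"
proof -
  have [measurable]: "N (take i v) \<in> measurable (info (up_to_level n)) (count_space UNIV)" for i
    by (rule measurable_info_N) (use assms in \<open>auto simp: up_to_level_def\<close>)
  have "partial_sum v \<in> borel_measurable (info (up_to_level n))"
    unfolding partial_sum_def
  proof (intro borel_measurable_sum borel_measurable_times borel_measurable_const)
    fix i assume "i \<in> {..<length v}"
    then show "\<eta> (take (Suc i) v) \<in> borel_measurable (info (up_to_level n))"
      by (intro measurable_info_eta) (use assms in \<open>auto simp: up_to_level_def\<close>)
  qed
  then have "Measurable.pred (info (up_to_level n)) (\<lambda>\<omega>. v \<in> gw_tree (\<lambda>v. N v \<omega>) \<and> K < \<bar>partial_sum v \<omega>\<bar>)"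
    unfolding gw_tree_def mem_Collect_eq by measurable
  from predE[OF this] show ?thesis
    by (simp only: large_at_def space_info)
qed

text \<open>A predecessor of \<open>v\<close> is never longer than \<open>v\<close>, so excluding it
  needs no information from deeper levels.\<close>

lemma first_large_at_sets: "first_large_at K v \<in> sets (info (up_to_level (length v)))"
  unfolding first_large_at_def
  by (intro sets.Diff large_at_sets sets.countable_UN'') (auto simp: precedes_def)

lemma disjoint_first_large_at: "disjoint_family (first_large_at K)"
proof -
  have tot: "v = w \<or> precedes v w \<or> precedes w v" for v w
    using inj_to_nat[THEN injD, of v w]
    by (cases "length v" "length w" rule: linorder_cases; cases "to_nat v" "to_nat w" rule: linorder_cases)
       (auto simp: precedes_def)
  show ?thesis
    unfolding disjoint_family_on_def
  proof safe
    fix v w \<omega> assume "v \<noteq> w" "\<omega> \<in> first_large_at K v" "\<omega> \<in> first_large_at K w"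
    with tot[of v w] show "\<omega> \<in> {}" by (auto simp: first_large_at_def)
  qed
qed

lemma UN_first_large_at: "(\<Union>v. first_large_at K v) = (\<Union>v. large_at K v)"
proof safe
  fix \<omega> v assume "\<omega> \<in> large_at K v"
  then obtain w where w: "\<omega> \<in> large_at K w" "\<And>u. (u, w) \<in> measures [length, to_nat] \<Longrightarrow> \<omega> \<notin> large_at K u"
    by - (rule wfE_min[OF wf_measures[of "[length, to_nat]"], of v "{v. \<omega> \<in> large_at K v}"], auto)
  then show "\<omega> \<in> (\<Union>v. first_large_at K v)"
    by (auto simp: first_large_at_def precedes_def)
qed (auto simp: first_large_at_def)

end

section \<open>Continuing along the leftmost path\<close>

locale dbrw_with_moment = infinite_moment_dbrw M Z Y N \<eta> m H
  for M :: "'w measure" and Z Y N \<eta> and m H :: real +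
  fixes a :: real
  assumes a_pos: "0 < a" and a_le_1: "a \<le> 1"
    and a_moment: "(\<integral>\<^sup>+y. ennreal (\<bar>y\<bar> powr a) \<partial>Y) < \<infinity>"
begin

text \<open>The discount is counted from \<open>v\<close> instead of the root. This only enlarges
  the terms and makes the expectation the same for all \<open>v\<close>; the power \<open>a\<close>
  matches the available moment.\<close>

definition leftmost_tail :: "nat list \<Rightarrow> 'w \<Rightarrow> ennreal" where
  "leftmost_tail v \<omega> = (\<Sum>i. ennreal ((m powr (- (real (Suc i) * H)) * \<bar>\<eta> (v @ replicate (Suc i) 0) \<omega>\<bar>) powr a))"

definition tail_constant :: real where
  "tail_constant = (\<Sum>i. m powr (- (real (Suc i) * H * a))) * enn2real (\<integral>\<^sup>+y. ennreal (\<bar>y\<bar> powr a) \<partial>Y)"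

lemma leftmost_tail_measurable: "leftmost_tail v \<in> borel_measurable (info (beyond_level (length v)))"
proof -
  have [measurable]: "\<eta> (v @ replicate (Suc i) 0) \<in> borel_measurable (info (beyond_level (length v)))" for i
    by (rule measurable_info_eta) (auto simp: beyond_level_def)
  show ?thesis unfolding leftmost_tail_def by measurable
qed

lemma summable_weights: "summable (\<lambda>i. m powr (- (real (Suc i) * H * a)))"
proof -
  have "summable (\<lambda>i. (m powr (- (H * a))) ^ Suc i)"
    using m_gt_1 H_pos a_pos by (subst summable_Suc_iff) (auto intro!: summable_geometric simp: powr_less_one)
  also have "(\<lambda>i. (m powr (- (H * a))) ^ Suc i) = (\<lambda>i. m powr (- (real (Suc i) * H * a)))"
    using m_gt_1 powr_power[of m "- (H * a)"] by (auto simp: fun_eq_iff algebra_simps simp del: power_Suc)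
  finally show ?thesis .
qed

lemma nn_integral_leftmost_tail: "(\<integral>\<^sup>+\<omega>. leftmost_tail v \<omega> \<partial>M) = ennreal tail_constant"
proof -
  let ?I = "\<integral>\<^sup>+y. ennreal (\<bar>y\<bar> powr a) \<partial>Y"
  let ?q = "\<lambda>i. m powr (- (real (Suc i) * H * a))"
  have I: "?I = ennreal (enn2real ?I)" using a_moment by (simp add: less_top[symmetric])
  have [measurable]: "\<eta> (v @ replicate (Suc i) 0) \<in> borel_measurable M" for i
    by (rule \<eta>_measurable) simp
  have "(\<integral>\<^sup>+\<omega>. leftmost_tail v \<omega> \<partial>M)
      = (\<Sum>i. \<integral>\<^sup>+\<omega>. ennreal ((m powr (- (real (Suc i) * H)) * \<bar>\<eta> (v @ replicate (Suc i) 0) \<omega>\<bar>) powr a) \<partial>M)"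
    unfolding leftmost_tail_def by (intro nn_integral_suminf) measurable
  also have "\<dots> = (\<Sum>i. ennreal (?q i) * ?I)"
  proof (intro suminf_cong)
    fix i
    have "(\<integral>\<^sup>+\<omega>. ennreal ((m powr (- (real (Suc i) * H)) * \<bar>\<eta> (v @ replicate (Suc i) 0) \<omega>\<bar>) powr a) \<partial>M)
        = (\<integral>\<^sup>+y. ennreal ((m powr (- (real (Suc i) * H)) * \<bar>y\<bar>) powr a) \<partial>Y)"
      by (rule nn_integral_eta) auto
    also have "\<dots> = (\<integral>\<^sup>+y. ennreal (?q i) * ennreal (\<bar>y\<bar> powr a) \<partial>Y)"
      by (intro nn_integral_cong) (simp add: powr_mult powr_powr ennreal_mult)
    also have "\<dots> = ennreal (?q i) * ?I"
      by (rule nn_integral_cmult) simp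
    finally show "(\<integral>\<^sup>+\<omega>. ennreal ((m powr (- (real (Suc i) * H)) * \<bar>\<eta> (v @ replicate (Suc i) 0) \<omega>\<bar>) powr a) \<partial>M)
       = ennreal (?q i) * ?I" .
  qed
  also have "\<dots> = (\<Sum>i. ennreal (?q i)) * ?I" by simp
  also have "\<dots> = ennreal tail_constant"
    unfolding tail_constant_def using summable_weights I by (subst suminf_ennreal2) (auto simp: ennreal_mult'')
  finally show ?thesis .
qed

definition small_tail :: "real \<Rightarrow> nat list \<Rightarrow> 'w set" where
  "small_tail b v = {\<omega>\<in>space M. leftmost_tail v \<omega> \<le> ennreal b}"

lemma small_tail_sets: "small_tail b v \<in> sets (info (beyond_level (length v)))"
proof -
  have "Measurable.pred (info (beyond_level (length v))) (\<lambda>\<omega>. leftmost_tail v \<omega> \<le> ennreal b)"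
    using leftmost_tail_measurable[of v] by measurable
  from predE[OF this] show ?thesis by (simp only: small_tail_def space_info)
qed

lemma up_to_level_subset: "up_to_level n \<subseteq> indices" and beyond_level_subset: "beyond_level n \<subseteq> indices"
  and levels_disjoint: "up_to_level n \<inter> beyond_level n = {}"
  by (auto simp: up_to_level_def beyond_level_def indices_def)

text \<open>Markov's inequality, with a bound uniform in \<open>v\<close>.\<close>

lemma prob_small_tail_ge:
  assumes "b > 0"
  shows "1 - tail_constant / b \<le> prob (small_tail b v)"
proof -
  have events: "small_tail b v \<in> events"
    by (rule sets_info_events[OF beyond_level_subset small_tail_sets])
  have [measurable]: "leftmost_tail v \<in> borel_measurable M"
  proof -
    have [measurable]: "\<eta> (v @ replicate (Suc i) 0) \<in> borel_measurable M" for i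
      by (rule \<eta>_measurable) simp
    show ?thesis unfolding leftmost_tail_def by measurable
  qed
  have nn: "0 \<le> tail_constant" unfolding tail_constant_def
    by (intro mult_nonneg_nonneg suminf_nonneg summable_weights) auto
  have "emeasure M (space M - small_tail b v) \<le> emeasure M {\<omega>\<in>space M. 1 \<le> ennreal (1 / b) * leftmost_tail v \<omega>}"
  proof (intro emeasure_mono)
    show "space M - small_tail b v \<subseteq> {\<omega>\<in>space M. 1 \<le> ennreal (1 / b) * leftmost_tail v \<omega>}"
    proof
      fix \<omega> assume "\<omega> \<in> space M - small_tail b v"
      then have \<omega>: "\<omega> \<in> space M" "ennreal b \<le> leftmost_tail v \<omega>" by (auto simp: small_tail_def)
      have "1 = ennreal (1 / b) * ennreal b" using assms by (subst ennreal_mult[symmetric]) auto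
      also have "\<dots> \<le> ennreal (1 / b) * leftmost_tail v \<omega>" using \<omega>(2) by (intro mult_left_mono) auto
      finally show "\<omega> \<in> {\<omega>\<in>space M. 1 \<le> ennreal (1 / b) * leftmost_tail v \<omega>}" using \<omega> by simp
    qed
  qed measurable
  also have "\<dots> \<le> ennreal (1 / b) * (\<integral>\<^sup>+\<omega>. leftmost_tail v \<omega> * indicator (space M) \<omega> \<partial>M)"
    by (rule nn_integral_Markov_inequality) auto
  also have "(\<integral>\<^sup>+\<omega>. leftmost_tail v \<omega> * indicator (space M) \<omega> \<partial>M) = (\<integral>\<^sup>+\<omega>. leftmost_tail v \<omega> \<partial>M)"
    by (intro nn_integral_cong) auto
  also have "ennreal (1 / b) * \<dots> = ennreal (tail_constant / b)"
    unfolding nn_integral_leftmost_tail using assms by (simp add: ennreal_mult'[symmetric])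
  finally have "prob (space M - small_tail b v) \<le> tail_constant / b"
    using nn assms by (simp add: emeasure_eq_measure)
  then show ?thesis using prob_compl[OF events] by simp
qed

text \<open>
  The first vertex with a large partial sum is determined by the levels up to its own, so it is
  independent of the increments on the leftmost path below it.
\<close>

lemma prob_large_with_small_tail:
  assumes "K > 0" "b > 0"
  shows "1 - tail_constant / b \<le> prob (\<Union>v. large_at K v \<inter> small_tail b v)"
proof (cases "tail_constant / b \<le> 1")
  case False
  then show ?thesis using measure_nonneg[of M] by (intro order_trans[OF _ measure_nonneg]) simp
next
  case True
  have ev: "large_at K v \<in> events" "first_large_at K v \<in> events" "small_tail b v \<in> events" for v
    using sets_info_events[OF up_to_level_subset large_at_sets[OF order_refl]]
      sets_info_events[OF up_to_level_subset first_large_at_sets]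
      sets_info_events[OF beyond_level_subset small_tail_sets] by auto
  \<comment> \<open>Almost surely exactly one vertex is the first with a large partial sum, so these
    probabilities sum to 1.\<close>
  have "(\<integral>\<^sup>+v. emeasure M (first_large_at K v) \<partial>count_space UNIV) = emeasure M (\<Union>v. first_large_at K v)"
    using ev by (intro emeasure_UN_countable[symmetric] disjoint_first_large_at) auto
  also have "\<dots> = 1"
  proof -
    have "AE \<omega> in M. \<omega> \<in> (\<Union>v. large_at K v)"
      using AE_large_partial_sum[OF assms(1)] AE_space
      by eventually_elim (auto simp: large_at_def)
    then show ?thesis
      unfolding UN_first_large_at using ev by (intro emeasure_eq_1_AE) auto
  qed
  finally have one: "(\<integral>\<^sup>+v. emeasure M (first_large_at K v) \<partial>count_space UNIV) = 1" .
  have "ennreal (1 - tail_constant / b) = (\<integral>\<^sup>+v. emeasure M (first_large_at K v) * ennreal (1 - tail_constant / b) \<partial>count_space UNIV)"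
    by (simp add: nn_integral_multc one)
  also have "\<dots> \<le> (\<integral>\<^sup>+v. emeasure M (first_large_at K v) * emeasure M (small_tail b v) \<partial>count_space UNIV)"
    unfolding emeasure_eq_measure[of "small_tail b _"]
    by (intro nn_integral_mono mult_left_mono ennreal_leI prob_small_tail_ge assms) auto
  also have "\<dots> = (\<integral>\<^sup>+v. emeasure M (first_large_at K v \<inter> small_tail b v) \<partial>count_space UNIV)"
    by (intro nn_integral_cong emeasure_Int_info[symmetric, OF levels_disjoint up_to_level_subset beyond_level_subset
          first_large_at_sets small_tail_sets])
  also have "\<dots> = emeasure M (\<Union>v. first_large_at K v \<inter> small_tail b v)"
    using ev disjoint_first_large_at[of K]
    by (intro emeasure_UN_countable[symmetric]) (auto 0 3 simp: disjoint_family_on_def)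
  also have "\<dots> \<le> emeasure M (\<Union>v. large_at K v \<inter> small_tail b v)"
    using ev by (intro emeasure_mono sets.countable_UN sets.Int) (auto simp: first_large_at_def)
  finally show ?thesis by (simp add: emeasure_eq_measure)
qed

lemma AE_positive_offspring: "AE \<omega> in M. \<forall>v. N v \<omega> \<ge> 1"
proof -
  have "AE \<omega> in M. N v \<omega> \<ge> 1" for v
  proof -
    have "AE k in distr M (count_space UNIV) (N v). k \<ge> 1"
      unfolding N_distr AE_measure_pmf_iff using set_pmf_pos by blast
    then show ?thesis by (subst (asm) AE_distr_iff[OF N_measurable]) auto
  qed
  then show ?thesis by (simp add: AE_all_countable)
qed

text \<open>The ray through \<open>v\<close> that continues leftmost has a head above
  \<open>2 * b powr (1 / a)\<close> in absolute value, and its tail can cancel at most half of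
  this.\<close>

lemma dbrw_sup_ge:
  assumes pos: "\<And>v. N v \<omega> \<ge> 1" and b: "b > 0"
    and \<omega>: "\<omega> \<in> large_at (2 * b powr (1 / a)) v \<inter> small_tail b v"
  shows "ennreal (b powr (1 / a)) \<le> dbrw_sup m H (\<lambda>v. N v \<omega>) (\<lambda>v. \<eta> v \<omega>)"
proof -
  let ?n = "length v" and ?d = "dbrw_term m H (\<lambda>v. \<eta> v \<omega>)"
  define t where "t i = (if i < length v then v ! i else 0)" for i
  define x where "x i = m powr (- (real (Suc i) * H)) * \<bar>\<eta> (v @ replicate (Suc i) 0) \<omega>\<bar>" for i
  have vT: "v \<in> gw_tree (\<lambda>v. N v \<omega>)" and large: "2 * b powr (1 / a) < \<bar>partial_sum v \<omega>\<bar>"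
    using \<omega> by (auto simp: large_at_def)
  have "(\<Sum>i. ennreal (x i powr a)) \<le> ennreal b"
    using \<omega> unfolding x_def small_tail_def leftmost_tail_def by blast
  from summable_of_powr_summable[OF _ a_pos a_le_1 b this]
  have x: "summable x" "suminf x \<le> b powr (1 / a)"
    unfolding x_def by simp_all
  have ray1: "ray_vertex t i = take i v" if "i \<le> ?n" for i
    using that by (intro nth_equalityI) (auto simp: ray_vertex_def t_def)
  have ray2: "ray_vertex t (i + ?n) = v @ replicate i 0" for i
    by (intro nth_equalityI) (auto simp: ray_vertex_def t_def nth_append)
  have "t i < N (ray_vertex t i) \<omega>" for i
  proof (cases "i < ?n")
    case True
    then show ?thesis using vT ray1[of i] by (auto simp: gw_tree_def t_def)
  next
    case False
    then show ?thesis using pos[of "ray_vertex t i"] by (simp add: t_def)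
  qed
  then have t_ray: "t \<in> rays (\<lambda>v. N v \<omega>)"
    by (auto simp: rays_def gw_tree_def) (simp add: ray_vertex_def)
  \<comment> \<open>Discounting from \<open>v\<close> dominates discounting from the root.\<close>
  have tail_le: "\<bar>?d t (i + ?n)\<bar> \<le> x i" for i
  proof -
    have "m powr (- (real (Suc (i + ?n)) * H)) \<le> m powr (- (real (Suc i) * H))"
      using m_gt_1 H_pos by (intro powr_mono) (auto intro!: mult_right_mono)
    then show ?thesis
      using ray2[of "Suc i"] by (auto simp: dbrw_term_def x_def abs_mult intro!: mult_right_mono)
  qed
  have s_abs: "summable (\<lambda>i. \<bar>?d t (i + ?n)\<bar>)"
    by (rule summable_comparison_test'[OF x(1), of 0]) (simp add: tail_le)
  then have s_shift: "summable (\<lambda>i. ?d t (i + ?n))" by (rule summable_rabs_cancel)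
  then have s: "summable (?d t)" by (subst (asm) summable_iff_shift)
  have "\<bar>\<Sum>i. ?d t (i + ?n)\<bar> \<le> (\<Sum>i. \<bar>?d t (i + ?n)\<bar>)"
    by (rule summable_rabs[OF s_abs])
  also have "\<dots> \<le> suminf x" by (intro suminf_le tail_le s_abs x)
  finally have "\<bar>\<Sum>i. ?d t (i + ?n)\<bar> \<le> b powr (1 / a)" using x(2) by simp
  moreover have "dbrw m H (\<lambda>v. \<eta> v \<omega>) t = (\<Sum>i. ?d t (i + ?n)) + (\<Sum>i<?n. ?d t i)"
    unfolding dbrw_def by (rule suminf_split_initial_segment[OF s])
  moreover have "(\<Sum>i<?n. ?d t i) = partial_sum v \<omega>"
    unfolding partial_sum_def by (intro sum.cong) (auto simp: dbrw_term_def ray1)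
  ultimately have "b powr (1 / a) \<le> \<bar>dbrw m H (\<lambda>v. \<eta> v \<omega>) t\<bar>"
    using large by linarith
  then show ?thesis
    unfolding dbrw_sup_def using t_ray s by (intro SUP_upper2[of t] ennreal_leI) auto
qed

text \<open>With \<open>b = Suc k\<close> the good event has probability at least
  \<open>1 - tail_constant / b\<close>, so almost surely good events occur for arbitrarily large
  \<open>k\<close>.\<close>

lemma AE_dbrw_sup_infinite:
  "AE \<omega> in M. dbrw_sup m H (\<lambda>v. N v \<omega>) (\<lambda>v. \<eta> v \<omega>) = \<infinity>"
proof -
  define G where "G k = (\<Union>v. large_at (2 * real (Suc k) powr (1 / a)) v \<inter> small_tail (real (Suc k)) v)" for k
  have G: "G k \<in> events" for k
    unfolding G_def
    using sets_info_events[OF up_to_level_subset large_at_sets[OF order_refl]]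
      sets_info_events[OF beyond_level_subset small_tail_sets]
    by (intro sets.countable_UN sets.Int) auto
  have lim: "(\<lambda>k. tail_constant / real (Suc k)) \<longlonglongrightarrow> 0"
    by (rule LIMSEQ_Suc[OF lim_const_over_n])
  \<comment> \<open>No independence between the \<open>G k\<close> is used: the event that all of
    them fail from \<open>k0\<close> on is contained in each single failure, whose probability tends
    to 0.\<close>
  have AE_G: "AE \<omega> in M. \<exists>k\<ge>k0. \<omega> \<in> G k" for k0
  proof -
    let ?B = "\<Inter>k\<in>{k0..}. space M - G k"
    have B: "?B \<in> events" using G by (intro sets.countable_INT') auto
    have "prob ?B \<le> tail_constant / real (Suc k)" if "k \<ge> k0" for k
    proof -
      have "prob ?B \<le> prob (space M - G k)"
        using that G by (intro finite_measure_mono) auto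
      also have "\<dots> = 1 - prob (G k)" by (rule prob_compl[OF G])
      also have "\<dots> \<le> tail_constant / real (Suc k)"
        using prob_large_with_small_tail[of "2 * real (Suc k) powr (1 / a)" "real (Suc k)"] by (simp add: G_def)
      finally show ?thesis .
    qed
    then have "prob ?B \<le> 0"
      by (intro LIMSEQ_le_const[OF lim]) auto
    then have "emeasure M ?B = 0"
      by (simp add: emeasure_eq_measure measure_le_0_iff)
    then have "AE \<omega> in M. \<omega> \<notin> ?B" by (intro AE_not_in null_setsI B)
    then show ?thesis using AE_space by eventually_elim auto
  qed
  then have "AE \<omega> in M. \<forall>k0. \<exists>k\<ge>k0. \<omega> \<in> G k" by (simp add: AE_all_countable)
  then show ?thesis
    using AE_positive_offspring
  proof eventually_elim
    case (elim \<omega>)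
    let ?s = "dbrw_sup m H (\<lambda>v. N v \<omega>) (\<lambda>v. \<eta> v \<omega>)"
    have "of_nat k0 \<le> ?s" for k0
    proof -
      from elim(1) obtain k v where k: "k \<ge> k0"
        "\<omega> \<in> large_at (2 * real (Suc k) powr (1 / a)) v \<inter> small_tail (real (Suc k)) v"
        unfolding G_def by blast
      have "real k0 \<le> real (Suc k) powr 1" using k(1) by simp
      also have "\<dots> \<le> real (Suc k) powr (1 / a)" using a_pos a_le_1 by (intro powr_mono) auto
      finally have "ennreal (real k0) \<le> ennreal (real (Suc k) powr (1 / a))" by (rule ennreal_leI)
      also have "\<dots> \<le> ?s" using elim(2) k(2) by (intro dbrw_sup_ge) auto
      finally show ?thesis by (simp add: ennreal_of_nat_eq_real_of_nat)
    qed
    then show ?case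
      by (metis ennreal_Ex_less_of_nat infinity_ennreal_def leD less_top)
  qed
qed

end

section \<open>Assembly of the three claims\<close>

theorem theorem1:
  fixes M :: "'w measure" and Z :: "nat pmf" and Y :: "real measure"
    and N :: "nat list \<Rightarrow> 'w \<Rightarrow> nat" and \<eta> :: "nat list \<Rightarrow> 'w \<Rightarrow> real"
    and H m \<alpha> :: real
  assumes H_pos: "H > 0"
    and Z_integrable: "integrable (measure_pmf Z) real"
    and m_eq: "m = measure_pmf.expectation Z real"
    and m_gt_1: "m > 1"
    and Y_distribution: "real_distribution Y"
    and \<alpha>_pos: "\<alpha> > 0"
    and Y_moment: "(\<integral>\<^sup>+y. ennreal (\<bar>y\<bar> powr \<alpha>) \<partial>Y) < \<infinity>"
    and environment: "dbrw_environment M Z Y N \<eta>"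
  shows
    "((\<exists>q>max (1 / H) 1. (\<integral>\<^sup>+k. ennreal (real k powr q) \<partial>measure_pmf Z) < \<infinity>)
        \<and> (\<integral>\<^sup>+y. ennreal (\<bar>y\<bar> powr (1 / H)) \<partial>Y) < \<infinity>
      \<longrightarrow> (AE \<omega> in M.
             (\<forall>t\<in>rays (\<lambda>v. N v \<omega>). summable (dbrw_term m H (\<lambda>v. \<eta> v \<omega>) t))
             \<and> dbrw_sup m H (\<lambda>v. N v \<omega>) (\<lambda>v. \<eta> v \<omega>) < \<infinity>))
     \<and>
     (measure_pmf.prob Z {0} = 0
        \<and> (\<integral>\<^sup>+k. ennreal (real k * ln (real k)) \<partial>measure_pmf Z) < \<infinity>
        \<and> (\<integral>\<^sup>+y. ennreal (\<bar>y\<bar> powr (1 / H)) \<partial>Y) = \<infinity>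
      \<longrightarrow> (AE \<omega> in M. dbrw_sup m H (\<lambda>v. N v \<omega>) (\<lambda>v. \<eta> v \<omega>) = \<infinity>))
     \<and>
     ((\<forall>n::nat. (\<integral>\<^sup>+k. ennreal (real k ^ n) \<partial>measure_pmf Z) < \<infinity>)
        \<and> measure_pmf.prob Z {0} = 0
      \<longrightarrow> (\<forall>H'>0. (AE \<omega> in M. dbrw_sup m H' (\<lambda>v. N v \<omega>) (\<lambda>v. \<eta> v \<omega>) < \<infinity>)
                   \<longleftrightarrow> (\<integral>\<^sup>+y. ennreal (\<bar>y\<bar> powr (1 / H')) \<partial>Y) < \<infinity>))"
proof -
  interpret env: dbrw_environment M Z Y N \<eta> by (rule environment)
  have bounded: "AE \<omega> in M. (\<forall>t\<in>rays (\<lambda>v. N v \<omega>). summable (dbrw_term m h (\<lambda>v. \<eta> v \<omega>) t))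
      \<and> dbrw_sup m h (\<lambda>v. N v \<omega>) (\<lambda>v. \<eta> v \<omega>) < \<infinity>"
    if "h > 0" "(\<integral>\<^sup>+y. ennreal (\<bar>y\<bar> powr (1 / h)) \<partial>Y) < \<infinity>" for h
  proof -
    interpret Y: real_distribution Y by (rule Y_distribution)
    interpret finite_moment_dbrw M Z Y N \<eta> h m
      by unfold_locales (fact that m_gt_1 Z_integrable m_eq Y_distribution)+
    show ?thesis by (rule AE_bounded)
  qed
  have unbounded: "AE \<omega> in M. dbrw_sup m h (\<lambda>v. N v \<omega>) (\<lambda>v. \<eta> v \<omega>) = \<infinity>"
    if "h > 0" "measure_pmf.prob Z {0} = 0" "(\<integral>\<^sup>+k. ennreal (real k * ln (real k)) \<partial>measure_pmf Z) < \<infinity>"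
      "(\<integral>\<^sup>+y. ennreal (\<bar>y\<bar> powr (1 / h)) \<partial>Y) = \<infinity>" for h
  proof -
    interpret Y: real_distribution Y by (rule Y_distribution)
    \<comment> \<open>Lowering the exponent to at most 1 makes
      \<open>summable_of_powr_summable\<close> applicable; the moment of order \<open>a\<close>
      stays finite because the measure is finite.\<close>
    define a where "a = min \<alpha> 1"
    have a: "0 < a" "a \<le> 1" "a \<le> \<alpha>" using \<alpha>_pos by (auto simp: a_def)
    have "ennreal (\<bar>y\<bar> powr a) \<le> 1 + ennreal (\<bar>y\<bar> powr \<alpha>)" for y :: real
    proof -
      have "\<bar>y\<bar> powr a \<le> 1 + \<bar>y\<bar> powr \<alpha>"
        using powr_mono[of a \<alpha> "\<bar>y\<bar>"] powr_mono2[of a "\<bar>y\<bar>" 1] a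
        by (cases "\<bar>y\<bar> \<le> 1") (auto intro: add_increasing2 add_increasing)
      then have "ennreal (\<bar>y\<bar> powr a) \<le> ennreal (1 + \<bar>y\<bar> powr \<alpha>)" by (rule ennreal_leI)
      also have "\<dots> = 1 + ennreal (\<bar>y\<bar> powr \<alpha>)" by (subst ennreal_plus) auto
      finally show ?thesis .
    qed
    then have "(\<integral>\<^sup>+y. ennreal (\<bar>y\<bar> powr a) \<partial>Y) \<le> (\<integral>\<^sup>+y. 1 + ennreal (\<bar>y\<bar> powr \<alpha>) \<partial>Y)"
      by (intro nn_integral_mono)
    also have "\<dots> < \<infinity>"
      using Y_moment by (subst nn_integral_add) (auto simp: Y.emeasure_eq_measure)
    finally have a_moment: "(\<integral>\<^sup>+y. ennreal (\<bar>y\<bar> powr a) \<partial>Y) < \<infinity>" .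
    interpret dbrw_with_moment M Z Y N \<eta> m h a
      by unfold_locales (fact that a a_moment m_gt_1 Z_integrable m_eq Y_distribution)+
    show ?thesis by (rule AE_dbrw_sup_infinite)
  qed
  have log_moment: "(\<integral>\<^sup>+k. ennreal (real k * ln (real k)) \<partial>measure_pmf Z) < \<infinity>"
    if "\<And>n. (\<integral>\<^sup>+k. ennreal (real k ^ n) \<partial>measure_pmf Z) < \<infinity>"
  proof -
    \<comment> \<open>The second moment dominates \<open>Z log Z\<close>.\<close>
    have "real k * ln (real k) \<le> real k ^ 2" for k
      by (cases "k = 0") (auto simp: power2_eq_square intro!: mult_left_mono less_imp_le[OF ln_less_self])
    then have "(\<integral>\<^sup>+k. ennreal (real k * ln (real k)) \<partial>measure_pmf Z) \<le> (\<integral>\<^sup>+k. ennreal (real k ^ 2) \<partial>measure_pmf Z)"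
      by (intro nn_integral_mono ennreal_leI)
    then show ?thesis using that[of 2] by (rule le_less_trans)
  qed
  have "(AE \<omega> in M. dbrw_sup m h (\<lambda>v. N v \<omega>) (\<lambda>v. \<eta> v \<omega>) < \<infinity>)
      \<longleftrightarrow> (\<integral>\<^sup>+y. ennreal (\<bar>y\<bar> powr (1 / h)) \<partial>Y) < \<infinity>"
    if "\<And>n. (\<integral>\<^sup>+k. ennreal (real k ^ n) \<partial>measure_pmf Z) < \<infinity>" "measure_pmf.prob Z {0} = 0" "h > 0" for h
  proof
    assume fin: "AE \<omega> in M. dbrw_sup m h (\<lambda>v. N v \<omega>) (\<lambda>v. \<eta> v \<omega>) < \<infinity>"
    show "(\<integral>\<^sup>+y. ennreal (\<bar>y\<bar> powr (1 / h)) \<partial>Y) < \<infinity>"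
    proof (rule ccontr)
      assume "\<not> (\<integral>\<^sup>+y. ennreal (\<bar>y\<bar> powr (1 / h)) \<partial>Y) < \<infinity>"
      then have "(\<integral>\<^sup>+y. ennreal (\<bar>y\<bar> powr (1 / h)) \<partial>Y) = \<infinity>" by (simp add: less_top[symmetric])
      from fin unbounded[OF that(3,2) log_moment[OF that(1)] this] have "AE \<omega> in M. False"
        by eventually_elim simp
      then show False by simp
    qed
  next
    assume "(\<integral>\<^sup>+y. ennreal (\<bar>y\<bar> powr (1 / h)) \<partial>Y) < \<infinity>"
    from bounded[OF that(3) this] show "AE \<omega> in M. dbrw_sup m h (\<lambda>v. N v \<omega>) (\<lambda>v. \<eta> v \<omega>) < \<infinity>"
      by eventually_elim simp
  qed
  with bounded[OF H_pos] unbounded[OF H_pos] show ?thesis by blast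
qed

end
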